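(* Let $\{q_k : k\ge 0\}$ be a non-increasing sequence of positive numbers with $\lim_{n\to\infty}Q_n=\infty$, where $Q_n:=\sum_{k=0}^{n-1}q_k$ for $n\ge 1$. Let $t^{\ast}(f):=\sup_{n\ge 1}|t_n(f)|$ be the maximal operator of the associated Walsh-Nörlund means. Suppose that $t^{\ast}$ is bounded from $L_\infty(\mathbb{I})$ to $L_\infty(\mathbb{I})$, and let $p\in(1/2,1]$. Then $t^{\ast}$ is bounded from the dyadic Hardy space $H_p(\mathbb{I})$ to the space $L_p(\mathbb{I})$ if and only if $$\sup_{N}\frac{2^{N(1-p)}}{Q_{2^N}^{p}}\sum_{j=1}^{N}Q_{2^j}^{p}\,2^{j(p-1)}<\infty,$$ where the supremum is over $N\in\mathbb{N}$.
   Context: $\mathbb{N}$ is the set of non-negative integers and $\mathbb{I}:=[0,1)$ with Lebesgue measure. For $x\in\mathbb{I}$ write $x=\sum_{n\ge 0}x_n2^{-(n+1)}$, $x_n\in\{0,1\}$, for its dyadic expansion (for dyadic rationals, the expansion terminating in zeros). For $n\in\mathbb{N}$ write $n=\sum_{k\ge 0}\varepsilon_k(n)2^k$, $\varepsilon_k(n)\in\{0,1\}$. The Walsh-Paley functions are $w_n(x)=(-1)^{\sum_{j\ge 0}\varepsilon_j(n)x_j}$. For $f\in L_1(\mathbb{I})$, $\widehat f(i)=\int_{\mathbb{I}}f(t)w_i(t)\,dt$ and $S_M(f;x)=\sum_{i=0}^{M-1}\widehat f(i)w_i(x)$. The Walsh-Nörlund means with weights $\{q_k\}$ are $t_n(f;x)=\frac{1}{Q_n}\sum_{k=1}^{n}q_{n-k}S_k(f;x)$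 for $n\ge 1$. For $0<p<\infty$, $\|f\|_p:=\left(\int_{\mathbb{I}}|f|^p\right)^{1/p}$; $L_\infty(\mathbb{I})$ carries the (essential) supremum norm. The maximal function is $E^{\ast}(f;x)=\sup_{n\in\mathbb{N}}|S_{2^n}(f;x)|$. For $0<p<\infty$, the dyadic Hardy space $H_p(\mathbb{I})$ consists of all $f\in L_1(\mathbb{I})$ with $\|f\|_{H_p}:=\|E^{\ast}(f)\|_p<\infty$. "$t^{\ast}$ is bounded from $X$ to $Y$" means that there is a constant $c$ with $\|t^{\ast}(f)\|_Y\le c\|f\|_X$ for all $f\in X$. *)

theory Defs
  imports "HOL-Probability.Essential_Supremum"
begin

abbreviation unit_leb :: "real measure" where
  "unit_leb \<equiv> lebesgue_on {0..<1}"

text \<open>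
  The floor selects, at dyadic rationals, the expansion terminating in zeros; see
  \<open>dyadic_digit_sums\<close> and \<open>dyadic_digit_not_eventually_1\<close>, which together characterize the
  digits.
\<close>

definition dyadic_digit :: "real \<Rightarrow> nat \<Rightarrow> nat" where
  "dyadic_digit x n = nat (\<lfloor>2 ^ Suc n * x\<rfloor> mod 2)"

lemma dyadic_digit_le_1: "dyadic_digit x n \<le> 1"
  unfolding dyadic_digit_def by linarith

lemma dyadic_digit_partial_sum:
  assumes "0 \<le> x" "x < 1"
  shows "(\<Sum>n<m. real (dyadic_digit x n) / 2 ^ Suc n) = of_int \<lfloor>2 ^ m * x\<rfloor> / 2 ^ m"
proof (induction m)
  case 0
  have "\<lfloor>x\<rfloor> = 0" using assms by linarith
  then show ?case by simp
next
  case (Suc m)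
  define a where "a = \<lfloor>2 ^ Suc m * x\<rfloor>"
  have "\<lfloor>(2 ^ Suc m * x) / real_of_int 2\<rfloor> = a div 2"
    unfolding a_def by (rule floor_divide_real_eq_div) simp
  then have half: "\<lfloor>2 ^ m * x\<rfloor> = a div 2" by simp
  have "a = 2 * (a div 2) + a mod 2" by simp
  then have a: "real_of_int a = 2 * of_int (a div 2) + of_int (a mod 2)"
    by (metis of_int_add of_int_mult of_int_numeral)
  have "real (dyadic_digit x m) = of_int (a mod 2)"
    by (simp add: dyadic_digit_def a_def)
  then have "(\<Sum>n<Suc m. real (dyadic_digit x n) / 2 ^ Suc n)
      = of_int (a div 2) / 2 ^ m + of_int (a mod 2) / 2 ^ Suc m"
    using Suc.IH half by simp
  also have "\<dots> = of_int a / 2 ^ Suc m"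
    unfolding a by (simp add: field_simps)
  finally show ?case by (simp add: a_def)
qed

lemma dyadic_digit_sums:
  assumes "0 \<le> x" "x < 1"
  shows "(\<lambda>n. real (dyadic_digit x n) / 2 ^ Suc n) sums x"
proof -
  have lo: "x - (1/2) ^ m \<le> of_int \<lfloor>2 ^ m * x\<rfloor> / 2 ^ m" for m
  proof -
    have "2 ^ m * x - 1 \<le> of_int \<lfloor>2 ^ m * x\<rfloor>" by linarith
    then have "(2 ^ m * x - 1) / 2 ^ m \<le> of_int \<lfloor>2 ^ m * x\<rfloor> / 2 ^ m"
      by (rule divide_right_mono) simp
    then show ?thesis by (simp add: diff_divide_distrib power_one_over)
  qed
  have hi: "of_int \<lfloor>2 ^ m * x\<rfloor> / 2 ^ m \<le> x" for m
  proof -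
    have "of_int \<lfloor>2 ^ m * x\<rfloor> \<le> 2 ^ m * x" by linarith
    then show ?thesis by (simp add: field_simps)
  qed
  have "(\<lambda>m. x - (1/2::real) ^ m) \<longlonglongrightarrow> x - 0"
    by (intro tendsto_intros LIMSEQ_power_zero) simp
  then have "(\<lambda>m. x - (1/2::real) ^ m) \<longlonglongrightarrow> x" by simp
  then have "(\<lambda>m. of_int \<lfloor>2 ^ m * x\<rfloor> / 2 ^ m) \<longlonglongrightarrow> x"
    by (rule tendsto_sandwich[rotated 2]) (use lo hi in auto)
  then show ?thesis
    unfolding sums_def dyadic_digit_partial_sum[OF assms] .
qed

lemma dyadic_digit_not_eventually_1:
  assumes "0 \<le> x" "x < 1"
  shows "\<exists>n\<ge>m. dyadic_digit x n = 0"
proof (rule ccontr)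
  assume "\<not> ?thesis"
  then have one: "dyadic_digit x n = 1" if "n \<ge> m" for n
    using that dyadic_digit_le_1[of x n] by (metis le_less less_one)
  have "(\<lambda>n. real (dyadic_digit x (n + m)) / 2 ^ Suc (n + m)) sums
      (x - (\<Sum>n<m. real (dyadic_digit x n) / 2 ^ Suc n))"
    using dyadic_digit_sums[OF assms] by (rule sums_split_initial_segment)
  moreover have "(\<lambda>n. real (dyadic_digit x (n + m)) / 2 ^ Suc (n + m))
      = (\<lambda>n. (1/2) ^ m * (1/2) ^ Suc n)"
    by (simp add: one power_add power_one_over ac_simps)
  moreover have "(\<lambda>n. (1/2::real) ^ m * (1/2) ^ Suc n) sums ((1/2) ^ m * 1)"
    by (intro sums_mult power_half_series)
  ultimately have "x - of_int \<lfloor>2 ^ m * x\<rfloor> / 2 ^ m = (1/2) ^ m"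
    unfolding dyadic_digit_partial_sum[OF assms] using sums_unique2 by fastforce
  then have "2 ^ m * x = of_int \<lfloor>2 ^ m * x\<rfloor> + 1"
    by (simp add: field_simps power_one_over)
  then show False by linarith
qed

definition walsh :: "nat \<Rightarrow> real \<Rightarrow> real" where
  "walsh n x = (-1) ^ (\<Sum>j | bit n j. dyadic_digit x j)"

lemma finite_bits_nat: "finite {j. bit (n::nat) j}"
proof (rule finite_subset)
  show "{j. bit n j} \<subseteq> {..n}"
  proof (intro subsetI, simp, rule ccontr)
    fix j assume "bit n j" "\<not> j \<le> n"
    then have "n < 2 ^ j" by (meson less_exp less_trans not_le)
    with \<open>bit n j\<close> show False by (simp add: bit_iff_odd)
  qed
qed simp

definition walsh_coeff :: "(real \<Rightarrow> real) \<Rightarrow> nat \<Rightarrow> real" where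
  "walsh_coeff f i = (LINT t|unit_leb. f t * walsh i t)"

definition walsh_partial_sum :: "nat \<Rightarrow> (real \<Rightarrow> real) \<Rightarrow> real \<Rightarrow> real" where
  "walsh_partial_sum M f x = (\<Sum>i<M. walsh_coeff f i * walsh i x)"

definition Q_sum :: "(nat \<Rightarrow> real) \<Rightarrow> nat \<Rightarrow> real" where
  "Q_sum q n = (\<Sum>k<n. q k)"

definition norlund_mean :: "(nat \<Rightarrow> real) \<Rightarrow> nat \<Rightarrow> (real \<Rightarrow> real) \<Rightarrow> real \<Rightarrow> real" where
  "norlund_mean q n f x = (\<Sum>k=1..n. q (n - k) * walsh_partial_sum k f x) / Q_sum q n"

text \<open>Maximal functions may be infinite at some points, hence take values in \<^typ>\<open>ennreal\<close>.\<close>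

definition norlund_maximal :: "(nat \<Rightarrow> real) \<Rightarrow> (real \<Rightarrow> real) \<Rightarrow> real \<Rightarrow> ennreal" where
  "norlund_maximal q f x = (SUP n\<in>{1..}. ennreal \<bar>norlund_mean q n f x\<bar>)"

definition dyadic_maximal :: "(real \<Rightarrow> real) \<Rightarrow> real \<Rightarrow> ennreal" where
  "dyadic_maximal f x = (SUP n. ennreal \<bar>walsh_partial_sum (2 ^ n) f x\<bar>)"

text \<open>Intended for exponents \<open>p > 0\<close> only.\<close>

definition ennreal_powr :: "ennreal \<Rightarrow> real \<Rightarrow> ennreal" where
  "ennreal_powr a p = (if a = \<infinity> then \<infinity> else ennreal (enn2real a powr p))"

definition Lp_norm :: "real \<Rightarrow> (real \<Rightarrow> ennreal) \<Rightarrow> ennreal" where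
  "Lp_norm p g = ennreal_powr (\<integral>\<^sup>+x. ennreal_powr (g x) p \<partial>unit_leb) (1 / p)"

definition Linf_norm :: "(real \<Rightarrow> ennreal) \<Rightarrow> ennreal" where
  "Linf_norm g = esssup unit_leb g"

definition Linf_space :: "(real \<Rightarrow> real) set" where
  "Linf_space = {f. f \<in> borel_measurable unit_leb \<and> Linf_norm (\<lambda>x. ennreal \<bar>f x\<bar>) < \<infinity>}"

definition Hp_norm :: "real \<Rightarrow> (real \<Rightarrow> real) \<Rightarrow> ennreal" where
  "Hp_norm p f = Lp_norm p (dyadic_maximal f)"

definition Hp_space :: "real \<Rightarrow> (real \<Rightarrow> real) set" where
  "Hp_space p = {f. integrable unit_leb f \<and> Hp_norm p f < \<infinity>}"

definition bounded_operator ::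
  "((real \<Rightarrow> real) \<Rightarrow> real \<Rightarrow> ennreal) \<Rightarrow> (real \<Rightarrow> real) set \<Rightarrow>
    ((real \<Rightarrow> real) \<Rightarrow> ennreal) \<Rightarrow> ((real \<Rightarrow> ennreal) \<Rightarrow> ennreal) \<Rightarrow> bool" where
  "bounded_operator T X norm_X norm_Y \<longleftrightarrow>
    (\<exists>c\<ge>0. \<forall>f\<in>X. norm_Y (T f) \<le> ennreal c * norm_X f)"

end

theory Submission
  imports Defs "HOL-Probability.Probability_Measure"
begin

text \<open>
  The means are integral operators. Write \<open>D k x t\<close> for the Dirichlet kernel \<open>walsh_kernel\<close> and
  \<open>G n x t\<close> for the sum of \<open>q (n - k) * D k x t\<close> over \<open>k\<close> from \<open>1\<close> to \<open>n\<close>, which is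
  \<open>norlund_kernel\<close>. If \<open>x\<close> and \<open>t\<close> differ in
  digit \<open>s\<close>, then \<open>walsh i x * walsh i t\<close> changes sign whenever bit \<open>s\<close> of \<open>i\<close> is flipped. Hence
  \<open>D k x t\<close> is at most \<open>2 ^ Suc s\<close> in absolute value, and \<open>G n x t\<close> is at most \<open>2 ^ Suc s * Q_sum q n\<close>.
  If they differ in a further digit \<open>l > s\<close>, then \<open>D k x t\<close> as a function of \<open>k\<close> itself changes sign from one
  block of length \<open>2 ^ l\<close> to the next. Because the weights are monotone, summation against them telescopes,
  and \<open>G n x t\<close> is at most a constant times \<open>2 ^ s * Q_sum q (2 ^ Suc l)\<close>, whatever \<open>n\<close> is
  (\<open>norlund_kernel_bound_two_digits\<close>).

  Sufficiency. Let \<open>a\<close> be supported in a dyadic interval of length \<open>1 / 2 ^ N\<close>, bounded by \<open>B\<close>, with vanishing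
  Walsh coefficients below \<open>2 ^ N\<close>. On the interval the maximal operator is controlled by its boundedness on
  \<open>L\<^sub>\<infinity>\<close>. Off the interval only means with \<open>n > 2 ^ N\<close> can be non-zero, and the two kernel bounds apply, where
  \<open>s\<close> and \<open>l\<close> are the first two digits in which the point departs from the interval. The set belonging to \<open>s\<close> and \<open>l\<close> has
  measure at most \<open>1 / 2 ^ Suc l\<close>. Summing the \<open>p\<close>-th powers over \<open>s\<close> is a geometric sum; summing
  over \<open>l\<close> produces exactly the expression of the theorem, and the integral of the \<open>p\<close>-th power is at most a constant times
  \<open>B powr p / 2 ^ N\<close> (\<open>atom_estimate\<close>). A general \<open>f\<close> is decomposed into such pieces. The
  partial sums of order \<open>2 ^ n\<close> form a dyadic martingale, and its increments have predictable absolute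
  values. Grouping the levels at each point by the binary logarithm of a predictable majorant, rounded up, gives pieces that
  vanish or are atoms on each dyadic interval. The \<open>p\<close>-th powers of their bounds sum
  pointwise to a constant times the \<open>p\<close>-th power of the maximal function, since the majorant is at most three times
  that function. As \<open>p \<le> 1\<close>, the estimates for the atoms may be added (\<open>norlund_maximal_Hp_bound\<close>).

  Necessity. For the block of Walsh functions with index from \<open>2 ^ N\<close> to \<open>2 ^ Suc N - 1\<close> the maximal function is
  \<open>2 ^ N\<close> on \<open>[0, 1 / 2 ^ N)\<close> and \<open>0\<close> elsewhere. Its mean of order \<open>2 ^ N + 2 ^ j\<close> is, up to sign, a sum without
  cancellation on \<open>[0, 1 / 2 ^ j)\<close>, of size at least a constant times
  \<open>2 ^ j * Q_sum q (2 ^ j) / Q_sum q (2 ^ N)\<close>. Integrating over the shells \<open>[1 / 2 ^ Suc j, 1 / 2 ^ j)\<close> and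
  comparing the two norms gives the condition (\<open>condition_if_bounded\<close>).
\<close>

section \<open>Walsh sums and antiperiodic sequences\<close>

lemma abs_walsh [simp]: "\<bar>walsh i x\<bar> = 1"
  by (simp add: walsh_def power_abs)

lemma walsh_0 [simp]: "walsh 0 x = 1"
  by (simp add: walsh_def)

lemma bit_imp_less: "i < 2 ^ n \<Longrightarrow> bit (i::nat) j \<Longrightarrow> j < n"
  by (metis bit_take_bit_iff take_bit_nat_eq_self)

lemma walsh_add_power:
  assumes "\<not> bit i s"
  shows "walsh (i + 2 ^ s) x = (-1) ^ dyadic_digit x s * walsh i x"
proof -
  have "and i (2 ^ s) = 0"
    by (rule bit_eqI) (use assms in \<open>auto simp: bit_simps\<close>)
  then have "bit (i + 2 ^ s) j \<longleftrightarrow> bit i j \<or> j = s" for j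
    by (subst disjunctive_add_eq_or) (auto simp: bit_simps)
  then have "{j. bit (i + 2 ^ s) j} = insert s {j. bit i j}" by auto
  then show ?thesis
    using assms by (simp add: walsh_def finite_bits_nat power_add)
qed

lemma not_bit_block: "r < 2 ^ s \<Longrightarrow> \<not> bit (2 * 2 ^ s * m + r :: nat) s"
  using div_mult_self2[of "2 ^ s" r "2 * m"] by (simp add: bit_iff_odd ac_simps)

text \<open>
  The Dirichlet kernel at the dyadic sum of \<open>x\<close> and \<open>t\<close>. Keeping the two points apart
  replaces addition in the dyadic group by the question in which digits they differ.
\<close>

definition walsh_kernel :: "nat \<Rightarrow> real \<Rightarrow> real \<Rightarrow> real" where
  "walsh_kernel k x t = (\<Sum>i<k. walsh i x * walsh i t)"

definition antiperiodic :: "nat \<Rightarrow> (nat \<Rightarrow> real) \<Rightarrow> bool" where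
  "antiperiodic h u \<longleftrightarrow> (\<forall>m. \<forall>r<h. u (2 * h * m + h + r) = - u (2 * h * m + r))"

lemma antiperiodicD:
  "antiperiodic h u \<Longrightarrow> r < h \<Longrightarrow> u (2 * h * m + h + r) = - u (2 * h * m + r)"
  by (simp add: antiperiodic_def)

lemma sum_lessThan_add: "(\<Sum>k<a + b. u k) = (\<Sum>k<a. u k) + (\<Sum>r<b::nat. u (a + r :: nat) :: real)"
  by (induction b) auto

lemma sum_lessThan_block:
  fixes u :: "nat \<Rightarrow> real"
  shows "(\<Sum>k<2 * h * Suc m. u k)
    = (\<Sum>k<2 * h * m. u k) + (\<Sum>r<h. u (2 * h * m + r) + u (2 * h * m + h + r))"
proof -
  have "2 * h * Suc m = (2 * h * m + h) + h" by simp
  then show ?thesis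
    by (simp only: sum_lessThan_add sum.distrib add.assoc)
qed

lemma antiperiodic_sum_blocks:
  assumes "antiperiodic h u"
  shows "(\<Sum>k<2 * h * m. u k) = 0"
  by (induction m) (simp_all only: sum_lessThan_block, simp_all add: antiperiodicD[OF assms])

text \<open>
  Complete periods cancel, so at most one incomplete period of length \<open>2 * h\<close> survives.
\<close>

lemma antiperiodic_sum_bound:
  assumes "antiperiodic h u" "h > 0" and bound: "\<And>k. \<bar>u k\<bar> \<le> B"
  shows "\<bar>\<Sum>k<n. u k\<bar> \<le> real (2 * h) * B"
proof -
  have n: "n = 2 * h * (n div (2 * h)) + n mod (2 * h)" by simp
  have "\<bar>\<Sum>k<n. u k\<bar> = \<bar>\<Sum>r<n mod (2 * h). u (2 * h * (n div (2 * h)) + r)\<bar>"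
    by (subst n, subst sum_lessThan_add, subst antiperiodic_sum_blocks[OF assms(1)]) simp
  also have "\<dots> \<le> (\<Sum>r<n mod (2 * h). B)"
    by (rule order_trans[OF sum_abs]) (intro sum_mono bound)
  also have "\<dots> \<le> real (2 * h) * B"
  proof -
    have "n mod (2 * h) \<le> 2 * h" using \<open>h > 0\<close> by (intro less_imp_le mod_less_divisor) simp
    moreover have "0 \<le> B" using bound[of 0] by linarith
    ultimately show ?thesis by (simp add: mult_right_mono del: of_nat_mult)
  qed
  finally show ?thesis .
qed

lemma Q_sum_mono: "(\<And>k. q k \<ge> 0) \<Longrightarrow> m \<le> n \<Longrightarrow> Q_sum q m \<le> Q_sum q n"
  unfolding Q_sum_def by (intro sum_mono2) auto

text \<open>
  Within one period, antiperiodicity turns the weighted sum into a sum of increments of \<open>w\<close> over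
  distance \<open>h\<close>. Since \<open>w\<close> is monotone, the increments of consecutive periods fit together and
  telescope, so only the weights of the last half period remain.
\<close>

lemma antiperiodic_weighted_blocks:
  fixes w :: "nat \<Rightarrow> real"
  assumes u: "antiperiodic h u" and bound: "\<And>k. \<bar>u k\<bar> \<le> B"
    and w: "mono w" "\<And>k. w k \<ge> 0"
  shows "\<bar>\<Sum>k<2 * h * Suc m. w k * u k\<bar> \<le> B * (\<Sum>r<h. w (2 * h * m + h + r))"
proof -
  have B: "0 \<le> B" using bound[of 0] by linarith
  \<comment> \<open>One period: antiperiodicity replaces weights by their increments.\<close>
  have block: "\<bar>\<Sum>r<h. w (2 * h * m + r) * u (2 * h * m + r)
        + w (2 * h * m + h + r) * u (2 * h * m + h + r)\<bar>
      \<le> B * (\<Sum>r<h. w (2 * h * m + h + r) - w (2 * h * m + r))" (is "\<bar>\<Sum>r<h. ?f r\<bar> \<le> _") for m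
  proof -
    have "\<bar>?f r\<bar> \<le> B * (w (2 * h * m + h + r) - w (2 * h * m + r))" if "r < h" for r
    proof -
      have le: "w (2 * h * m + r) \<le> w (2 * h * m + h + r)" by (rule monoD[OF w(1)]) simp
      have "?f r = (w (2 * h * m + h + r) - w (2 * h * m + r)) * - u (2 * h * m + r)"
        unfolding antiperiodicD[OF u that, of m] by (simp add: algebra_simps)
      also have "\<bar>\<dots>\<bar> = (w (2 * h * m + h + r) - w (2 * h * m + r)) * \<bar>u (2 * h * m + r)\<bar>"
        using le by (simp add: abs_mult)
      also have "\<dots> \<le> (w (2 * h * m + h + r) - w (2 * h * m + r)) * B"
        using le bound by (intro mult_left_mono) auto
      finally show ?thesis by (simp add: mult.commute)
    qed
    then have "(\<Sum>r<h. \<bar>?f r\<bar>) \<le> (\<Sum>r<h. B * (w (2 * h * m + h + r) - w (2 * h * m + r)))"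
      by (intro sum_mono) simp
    then show ?thesis
      by (intro order_trans[OF sum_abs]) (simp add: sum_distrib_left)
  qed
  show ?thesis
  proof (induction m)
    case 0
    have "(\<Sum>r<h. w (h + r) - w r) \<le> (\<Sum>r<h. w (h + r))"
      using w(2) by (intro sum_mono) simp
    then show ?case
      using block[of 0] B by (subst sum_lessThan_block) (auto elim!: order_trans intro: mult_left_mono)
  next
    case (Suc m)
    have "(\<Sum>r<h. w (2 * h * m + h + r)) \<le> (\<Sum>r<h. w (2 * h * Suc m + r))"
      by (intro sum_mono monoD[OF w(1)]) simp
    then have "B * (\<Sum>r<h. w (2 * h * m + h + r))
        + B * (\<Sum>r<h. w (2 * h * Suc m + h + r) - w (2 * h * Suc m + r))
        \<le> B * (\<Sum>r<h. w (2 * h * Suc m + h + r))"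
      unfolding distrib_left[symmetric] sum_subtractf using B by (intro mult_left_mono) simp_all
    then show ?case
      using Suc.IH block[of "Suc m"] by (subst sum_lessThan_block) linarith
  qed
qed

text \<open>
  The gain over the trivial bound \<open>B * Q_sum q n\<close>: cancellation between half periods leaves only
  the largest weights, those of one period.
\<close>

lemma antiperiodic_weighted_sum_bound:
  assumes q: "decseq q" "\<And>k. q k \<ge> 0"
    and u: "antiperiodic h u" "h > 0" and bound: "\<And>k. \<bar>u k\<bar> \<le> B"
  shows "\<bar>\<Sum>k\<le>n. q (n - k) * u k\<bar> \<le> 2 * B * Q_sum q (2 * h)"
proof -
  define M where "M = n div (2 * h)"
  define r where "r = n mod (2 * h)"
  have n: "n = 2 * h * M + r" by (simp add: M_def r_def)
  have r: "r < 2 * h" using u(2) by (simp add: r_def)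
  have B: "0 \<le> B" using bound[of 0] by linarith
  \<comment> \<open>For \<open>k > n\<close> truncated subtraction gives the weight \<open>q 0\<close>, so monotonicity holds on all of \<open>nat\<close>.\<close>
  have w: "mono (\<lambda>k. q (n - k))"
    using q(1) by (auto simp: mono_def decseq_def)
  have blocks: "\<bar>\<Sum>k<2 * h * M. q (n - k) * u k\<bar> \<le> B * Q_sum q (2 * h)"
  proof (cases M)
    case 0
    then show ?thesis using B q(2) by (simp add: Q_sum_def sum_nonneg)
  next
    case (Suc m)
    have "\<bar>\<Sum>k<2 * h * M. q (n - k) * u k\<bar> \<le> B * (\<Sum>i<h. q (n - (2 * h * m + h + i)))"
      unfolding Suc by (rule antiperiodic_weighted_blocks[OF u(1) bound w q(2)])
    also have "(\<Sum>i<h. q (n - (2 * h * m + h + i))) \<le> (\<Sum>i<h. q (h - Suc i))"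
      using q(1) by (intro sum_mono) (auto simp: n Suc decseq_def)
    also have "(\<Sum>i<h. q (h - Suc i)) = Q_sum q h"
      unfolding Q_sum_def by (rule sum.nat_diff_reindex)
    also have "\<dots> \<le> Q_sum q (2 * h)" by (rule Q_sum_mono) (use q in auto)
    finally show ?thesis using B by (simp add: mult_left_mono)
  qed
  have "\<bar>\<Sum>i<Suc r. q (n - (2 * h * M + i)) * u (2 * h * M + i)\<bar> \<le> (\<Sum>i<Suc r. q (r - i) * B)"
    using q(2) bound by (intro order_trans[OF sum_abs] sum_mono) (auto simp: n abs_mult intro!: mult_left_mono)
  also have "\<dots> = B * (\<Sum>i<Suc r. q (Suc r - Suc i))"
    by (simp add: sum_distrib_left mult.commute del: sum.lessThan_Suc)
  also have "(\<Sum>i<Suc r. q (Suc r - Suc i)) = Q_sum q (Suc r)"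
    unfolding Q_sum_def by (rule sum.nat_diff_reindex)
  also have "B * \<dots> \<le> B * Q_sum q (2 * h)"
    using B r q(2) by (intro mult_left_mono Q_sum_mono) auto
  finally have tail: "\<bar>\<Sum>i<Suc r. q (n - (2 * h * M + i)) * u (2 * h * M + i)\<bar> \<le> B * Q_sum q (2 * h)" .
  have "(\<Sum>k\<le>n. q (n - k) * u k) = (\<Sum>k<2 * h * M + Suc r. q (n - k) * u k)"
    by (simp add: n lessThan_Suc_atMost)
  then show ?thesis
    using blocks tail unfolding sum_lessThan_add by linarith
qed

text \<open>
  Adding bit \<open>s\<close> to \<open>i\<close> multiplies \<open>walsh i x * walsh i t\<close> by \<open>-1\<close> exactly when \<open>x\<close> and \<open>t\<close>
  differ in digit \<open>s\<close>.
\<close>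

lemma antiperiodic_walsh:
  assumes "dyadic_digit x s \<noteq> dyadic_digit t s"
  shows "antiperiodic (2 ^ s) (\<lambda>i. walsh i x * walsh i t)"
  unfolding antiperiodic_def
proof (intro allI impI)
  fix m r :: nat assume "r < 2 ^ s"
  note nb = not_bit_block[OF this, of m]
  have sign: "(-1) ^ dyadic_digit x s * (-1) ^ dyadic_digit t s = (-1 :: real)"
    using assms dyadic_digit_le_1[of x s] dyadic_digit_le_1[of t s]
    by (auto simp: le_Suc_eq)
  have "walsh (2 * 2 ^ s * m + r + 2 ^ s) x * walsh (2 * 2 ^ s * m + r + 2 ^ s) t
      = ((-1) ^ dyadic_digit x s * (-1) ^ dyadic_digit t s)
        * (walsh (2 * 2 ^ s * m + r) x * walsh (2 * 2 ^ s * m + r) t)"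
    unfolding walsh_add_power[OF nb] by (simp only: ac_simps)
  then show "walsh (2 * 2 ^ s * m + 2 ^ s + r) x * walsh (2 * 2 ^ s * m + 2 ^ s + r) t
      = - (walsh (2 * 2 ^ s * m + r) x * walsh (2 * 2 ^ s * m + r) t)"
    unfolding sign by (simp only: add.assoc add.commute[of "2 ^ s" r] mult_minus1)
qed

lemma walsh_kernel_bound:
  assumes "dyadic_digit x s \<noteq> dyadic_digit t s"
  shows "\<bar>walsh_kernel k x t\<bar> \<le> 2 ^ Suc s"
  unfolding walsh_kernel_def
  using antiperiodic_sum_bound[OF antiperiodic_walsh[OF assms], of 1 k] by (simp add: abs_mult)

lemma walsh_kernel_power_eq_0:
  assumes "dyadic_digit x s \<noteq> dyadic_digit t s" "s < n"
  shows "walsh_kernel (2 ^ n * m) x t = 0"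
proof -
  have "2 ^ n * m = 2 * 2 ^ s * (2 ^ (n - Suc s) * m)"
    using assms(2) by (simp flip: power_Suc power_add mult.assoc)
  then show ?thesis
    unfolding walsh_kernel_def by (simp only: antiperiodic_sum_blocks[OF antiperiodic_walsh[OF assms(1)]])
qed

text \<open>
  A difference in digit \<open>s\<close> makes the kernel vanish at multiples of \<open>2 ^ l\<close>. Hence its values inside
  a block of length \<open>2 ^ l\<close> only sum terms of that block, and these change sign from one block to
  the next because of the difference in digit \<open>l\<close>.
\<close>

lemma antiperiodic_walsh_kernel:
  assumes s: "dyadic_digit x s \<noteq> dyadic_digit t s" and l: "dyadic_digit x l \<noteq> dyadic_digit t l"
    and "s < l"
  shows "antiperiodic (2 ^ l) (\<lambda>k. walsh_kernel k x t)"
  unfolding antiperiodic_def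
proof (intro allI impI)
  fix m r :: nat assume r: "r < 2 ^ l"
  have split: "walsh_kernel (2 ^ l * a + r) x t
      = (\<Sum>i<r. walsh (2 ^ l * a + i) x * walsh (2 ^ l * a + i) t)" for a
    using walsh_kernel_power_eq_0[OF s \<open>s < l\<close>, of a] by (simp add: walsh_kernel_def sum_lessThan_add)
  have "walsh_kernel (2 * 2 ^ l * m + 2 ^ l + r) x t
      = (\<Sum>i<r. walsh (2 * 2 ^ l * m + 2 ^ l + i) x * walsh (2 * 2 ^ l * m + 2 ^ l + i) t)"
    using split[of "2 * m + 1"] by (simp add: algebra_simps)
  also have "\<dots> = (\<Sum>i<r. - (walsh (2 * 2 ^ l * m + i) x * walsh (2 * 2 ^ l * m + i) t))"
    using r by (intro sum.cong refl antiperiodicD[OF antiperiodic_walsh[OF l]]) auto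
  also have "\<dots> = - walsh_kernel (2 * 2 ^ l * m + r) x t"
    using split[of "2 * m"] by (simp add: sum_negf algebra_simps)
  finally show "walsh_kernel (2 * 2 ^ l * m + 2 ^ l + r) x t = - walsh_kernel (2 * 2 ^ l * m + r) x t" .
qed

text \<open>
  The kernel of the mean before division by \<open>Q_sum q n\<close>.
\<close>

definition norlund_kernel :: "(nat \<Rightarrow> real) \<Rightarrow> nat \<Rightarrow> real \<Rightarrow> real \<Rightarrow> real" where
  "norlund_kernel q n x t = (\<Sum>k=1..n. q (n - k) * walsh_kernel k x t)"

lemma Q_sum_rev: "(\<Sum>k=1..n. q (n - k)) = Q_sum q n"
proof -
  have "(\<Sum>k=1..n. q (n - k)) = (\<Sum>k<n. q (n - Suc k))"
    by (rule sum.reindex_bij_witness[of _ Suc "\<lambda>k. k - 1"]) auto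
  then show ?thesis unfolding Q_sum_def by (simp add: sum.nat_diff_reindex)
qed

lemma norlund_kernel_bound_one_digit:
  assumes q: "\<And>k. q k \<ge> 0" and s: "dyadic_digit x s \<noteq> dyadic_digit t s"
  shows "\<bar>norlund_kernel q n x t\<bar> \<le> 2 ^ Suc s * Q_sum q n"
proof -
  have "\<bar>norlund_kernel q n x t\<bar> \<le> (\<Sum>k=1..n. q (n - k) * 2 ^ Suc s)"
    unfolding norlund_kernel_def
    using q walsh_kernel_bound[OF s]
    by (intro order_trans[OF sum_abs] sum_mono) (auto simp: abs_mult intro!: mult_left_mono)
  then show ?thesis unfolding sum_distrib_right[symmetric] Q_sum_rev by (simp add: mult.commute)
qed

text \<open>
  The decisive estimate: a second differing digit replaces \<open>Q_sum q n\<close> by \<open>Q_sum q (2 ^ Suc l)\<close>,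
  uniformly in \<open>n\<close>. It is the bound for antiperiodic sequences, applied to the Dirichlet kernels.
\<close>

lemma norlund_kernel_bound_two_digits:
  assumes q: "decseq q" "\<And>k. q k \<ge> 0"
    and s: "dyadic_digit x s \<noteq> dyadic_digit t s" and l: "dyadic_digit x l \<noteq> dyadic_digit t l"
    and "s < l"
  shows "\<bar>norlund_kernel q n x t\<bar> \<le> 2 * 2 ^ Suc s * Q_sum q (2 ^ Suc l)"
proof -
  have "norlund_kernel q n x t = (\<Sum>k\<le>n. q (n - k) * walsh_kernel k x t)"
    unfolding norlund_kernel_def
    by (rule sum.mono_neutral_left) (auto simp: walsh_kernel_def not_le)
  then show ?thesis
    using antiperiodic_weighted_sum_bound[OF q antiperiodic_walsh_kernel[OF s l \<open>s < l\<close>] _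
        walsh_kernel_bound[OF s], of n] by simp
qed

section \<open>Dyadic cells and orthogonality\<close>

definition agree :: "nat \<Rightarrow> real \<Rightarrow> real \<Rightarrow> bool" where
  "agree n x y \<longleftrightarrow> (\<forall>j<n. dyadic_digit x j = dyadic_digit y j)"

definition cell :: "nat \<Rightarrow> real \<Rightarrow> real set" where
  "cell n x = {y \<in> {0..<1}. agree n x y}"

text \<open>
  On the unit interval this is measurability with respect to the \<open>n\<close>-th dyadic sigma-algebra.
\<close>

definition dyadic_step :: "nat \<Rightarrow> (real \<Rightarrow> 'a) \<Rightarrow> bool" where
  "dyadic_step n \<phi> \<longleftrightarrow> (\<forall>x y. agree n x y \<longrightarrow> \<phi> x = \<phi> y)"

lemma dyadic_stepD: "dyadic_step n \<phi> \<Longrightarrow> agree n x y \<Longrightarrow> \<phi> x = \<phi> y"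
  by (auto simp: dyadic_step_def)

lemma agree_sym: "agree n x y \<longleftrightarrow> agree n y x" and agree_refl [simp]: "agree n x x"
  by (auto simp: agree_def)

lemma agree_trans: "agree n x y \<Longrightarrow> agree n y z \<Longrightarrow> agree n x z"
  by (auto simp: agree_def)

lemma agree_mono: "agree n x y \<Longrightarrow> m \<le> n \<Longrightarrow> agree m x y"
  by (auto simp: agree_def)

lemma floor_power_div:
  assumes "m \<le> n" shows "\<lfloor>2 ^ m * (x::real)\<rfloor> = \<lfloor>2 ^ n * x\<rfloor> div 2 ^ (n - m)"
proof -
  have "\<lfloor>2 ^ n * x / real_of_int (2 ^ (n - m))\<rfloor> = \<lfloor>2 ^ n * x\<rfloor> div 2 ^ (n - m)"
    by (rule floor_divide_real_eq_div) simp
  moreover have "2 ^ n * x / real_of_int (2 ^ (n - m)) = 2 ^ m * x"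
    using assms by (simp add: field_simps flip: power_add)
  ultimately show ?thesis by simp
qed

lemma agree_if_floor_eq:
  assumes "\<lfloor>2 ^ n * x\<rfloor> = \<lfloor>2 ^ n * y\<rfloor>" shows "agree n x y"
  unfolding agree_def
proof (intro allI impI)
  fix j assume "j < n"
  then show "dyadic_digit x j = dyadic_digit y j"
    using assms floor_power_div[of "Suc j" n x] floor_power_div[of "Suc j" n y]
    by (simp add: dyadic_digit_def)
qed

lemma agree_iff_floor_eq:
  assumes "0 \<le> x" "x < 1" "0 \<le> y" "y < 1"
  shows "agree n x y \<longleftrightarrow> \<lfloor>2 ^ n * x\<rfloor> = \<lfloor>2 ^ n * y\<rfloor>"
proof
  assume "agree n x y"
  then have "(\<Sum>j<n. real (dyadic_digit x j) / 2 ^ Suc j) = (\<Sum>j<n. real (dyadic_digit y j) / 2 ^ Suc j)"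
    by (intro sum.cong) (auto simp: agree_def)
  then show "\<lfloor>2 ^ n * x\<rfloor> = \<lfloor>2 ^ n * y\<rfloor>"
    using assms by (simp only: dyadic_digit_partial_sum) simp
qed (rule agree_if_floor_eq)

lemma cell_eq_interval:
  assumes "0 \<le> x" "x < 1"
  shows "cell n x = {of_int \<lfloor>2 ^ n * x\<rfloor> / 2 ^ n ..< (of_int \<lfloor>2 ^ n * x\<rfloor> + 1) / 2 ^ n}"
    (is "_ = {?a ..< ?b}")
proof -
  have "\<lfloor>2 ^ n * x\<rfloor> < 2 ^ n" using assms by (simp add: floor_less_iff)
  then have "real_of_int (\<lfloor>2 ^ n * x\<rfloor> + 1) \<le> real_of_int (2 ^ n)"
    by (subst of_int_le_iff) simp
  then have "?b \<le> 1" by simp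
  moreover have "0 \<le> ?a" using assms by simp
  ultimately have sub: "0 \<le> y \<and> y < 1" if "y \<in> {?a ..< ?b}" for y
    using that by (auto simp only: atLeastLessThan_iff)
  have iff: "y \<in> {?a ..< ?b} \<longleftrightarrow> \<lfloor>2 ^ n * x\<rfloor> = \<lfloor>2 ^ n * y\<rfloor>" for y
  proof -
    have "y \<in> {?a ..< ?b} \<longleftrightarrow> of_int \<lfloor>2 ^ n * x\<rfloor> \<le> 2 ^ n * y \<and> 2 ^ n * y < of_int \<lfloor>2 ^ n * x\<rfloor> + 1"
      by (simp add: divide_le_eq less_divide_eq mult.commute)
    then show ?thesis unfolding floor_eq_iff[symmetric] by (simp only: eq_commute)
  qed
  show ?thesis
    unfolding cell_def using sub iff agree_iff_floor_eq[OF assms] by (intro set_eqI) (metis (no_types, lifting) atLeastLessThan_iff mem_Collect_eq)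
qed

lemma emeasure_cell:
  assumes "0 \<le> x" "x < 1"
  shows "emeasure unit_leb (cell n x) = ennreal (1 / 2 ^ n)"
proof -
  have sub: "cell n x \<subseteq> {0..<1}" by (auto simp: cell_def)
  have "emeasure unit_leb (cell n x) = emeasure lebesgue (cell n x)"
    by (rule emeasure_restrict_space) (use sub in auto)
  also have "\<dots> = ennreal (1 / 2 ^ n)"
    unfolding cell_eq_interval[OF assms] by (simp add: divide_right_mono diff_divide_distrib[symmetric])
  finally show ?thesis .
qed

lemma sets_cell: "0 \<le> x \<Longrightarrow> x < 1 \<Longrightarrow> cell n x \<in> sets unit_leb"
proof -
  assume x: "0 \<le> x" "x < 1"
  have "cell n x \<subseteq> {0..<1}" by (auto simp: cell_def)
  then show ?thesis
    by (subst sets_restrict_space_iff) (auto simp: cell_eq_interval[OF x])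
qed

text \<open>
  Such a set is a cell, or empty when no point has the digits \<open>\<delta>\<close>.
\<close>

lemma digit_pattern_set:
  defines "E \<equiv> \<lambda>n \<delta>. {y \<in> {0..<1}. \<forall>j<n. dyadic_digit y j = \<delta> j}"
  shows "E n \<delta> \<in> sets unit_leb \<and> emeasure unit_leb (E n \<delta>) \<le> ennreal (1 / 2 ^ n)"
proof (cases "E n \<delta> = {}")
  case False
  then obtain x where x: "0 \<le> x" "x < 1" "\<forall>j<n. dyadic_digit x j = \<delta> j" by (auto simp: E_def)
  then have "E n \<delta> = cell n x" by (auto simp: E_def cell_def agree_def)
  then show ?thesis using sets_cell emeasure_cell x by simp
qed simp

lemma measurable_dyadic_step:
  fixes \<phi> :: "real \<Rightarrow> 'a::topological_space"
  assumes "dyadic_step n \<phi>" shows "\<phi> \<in> borel_measurable unit_leb"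
proof -
  have eq: "\<phi> = (\<lambda>x. \<phi> (of_int \<lfloor>2 ^ n * (x::real)\<rfloor> / 2 ^ n))"
    by (intro ext dyadic_stepD[OF assms] agree_if_floor_eq) simp
  have "(\<lambda>x::real. \<lfloor>2 ^ n * x\<rfloor>) \<in> borel \<rightarrow>\<^sub>M count_space UNIV" by measurable
  then have "(\<lambda>x::real. \<phi> (of_int \<lfloor>2 ^ n * x\<rfloor> / 2 ^ n)) \<in> borel_measurable borel"
    by (rule measurable_compose) simp
  then show ?thesis
    unfolding eq[symmetric] by (intro measurable_restrict_space1 measurable_completion) simp
qed

lemma walsh_agree: "i < 2 ^ n \<Longrightarrow> agree n x y \<Longrightarrow> walsh i x = walsh i y"
  unfolding walsh_def agree_def
  by (intro arg_cong[where f = "\<lambda>k. (-1) ^ k"] sum.cong) (auto dest: bit_imp_less)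

lemma dyadic_step_walsh: "i < 2 ^ n \<Longrightarrow> dyadic_step n (walsh i)"
  by (simp add: dyadic_step_def walsh_agree)

lemma measurable_walsh [measurable]: "walsh i \<in> borel_measurable unit_leb"
  by (rule measurable_dyadic_step[OF dyadic_step_walsh[OF less_exp]])

lemma space_unit_leb [simp]: "space unit_leb = {0..<1}"
  by simp

lemma emeasure_unit_leb_space: "emeasure unit_leb {0..<1} = 1"
  by (simp add: emeasure_restrict_space)

interpretation unit_leb: prob_space unit_leb
  by (rule prob_spaceI) (simp add: emeasure_unit_leb_space)

lemma integrable_if_bounded:
  fixes f :: "real \<Rightarrow> real"
  assumes "f \<in> borel_measurable unit_leb" "\<And>x. \<bar>f x\<bar> \<le> B"
  shows "integrable unit_leb f"
  by (rule unit_leb.integrable_const_bound[of _ B]) (use assms in auto)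

lemma integrable_mult_walsh:
  "integrable unit_leb f \<Longrightarrow> integrable unit_leb (\<lambda>x. f x * walsh i x)"
  by (rule Bochner_Integration.integrable_bound[of _ f]) (auto simp: abs_mult)

text \<open>
  Adding \<open>1 / 2 ^ Suc j\<close> to a point with digit \<open>j\<close> equal to \<open>0\<close> produces no carry. This shift
  is the only instance of dyadic translation that the proof relies on.
\<close>

lemma dyadic_digit_flip:
  assumes "dyadic_digit x j = 0"
  shows "dyadic_digit (x + 1 / 2 ^ Suc j) i = (if i = j then 1 else dyadic_digit x i)"
proof -
  let ?y = "x + 1 / 2 ^ Suc j"
  have even: "even \<lfloor>2 ^ Suc j * x\<rfloor>" using assms by (simp add: dyadic_digit_def even_iff_mod_2_eq_zero)
  have flip: "\<lfloor>2 ^ Suc j * ?y\<rfloor> = \<lfloor>2 ^ Suc j * x\<rfloor> + 1"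
    by (simp add: distrib_left)
  consider "i < j" | "i = j" | "i > j" by linarith
  then show ?thesis
  proof cases
    assume "i < j"
    have "\<lfloor>2 ^ j * ?y\<rfloor> = \<lfloor>2 ^ j * x\<rfloor>"
      using floor_power_div[of j "Suc j" ?y] floor_power_div[of j "Suc j" x] even flip by simp
    then have "agree j ?y x" by (rule agree_if_floor_eq)
    with \<open>i < j\<close> show ?thesis by (simp add: agree_def)
  next
    assume "i = j"
    moreover have "(\<lfloor>2 ^ Suc j * x\<rfloor> + 1) mod 2 = 1"
      using even by (simp only: odd_iff_mod_2_eq_one[symmetric]) simp
    ultimately show ?thesis using flip unfolding dyadic_digit_def by simp
  next
    assume "i > j"
    then have "(2::real) ^ Suc i = 2 ^ Suc j * (2 * 2 ^ (i - Suc j))"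
      by (simp flip: power_add power_Suc)
    then have "2 ^ Suc i * ?y = 2 ^ Suc i * x + of_int (2 * 2 ^ (i - Suc j))"
      unfolding distrib_left by simp
    then have "\<lfloor>2 ^ Suc i * ?y\<rfloor> = \<lfloor>2 ^ Suc i * x\<rfloor> + 2 * 2 ^ (i - Suc j)"
      by (metis floor_add_int)
    then show ?thesis using \<open>i > j\<close> unfolding dyadic_digit_def by simp
  qed
qed

lemma agree_flip: "dyadic_digit x j = 0 \<Longrightarrow> agree j (x + 1 / 2 ^ Suc j) x"
  by (simp add: agree_def dyadic_digit_flip del: power_Suc)

lemma walsh_flip:
  assumes "dyadic_digit x j = 0"
  shows "walsh i (x + 1 / 2 ^ Suc j) = (if bit i j then - walsh i x else walsh i x)"
proof -
  have "(\<Sum>k | bit i k. dyadic_digit (x + 1 / 2 ^ Suc j) k)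
      = (\<Sum>k | bit i k. dyadic_digit x k + (if k = j then 1 else 0))"
    using assms by (intro sum.cong) (auto simp: dyadic_digit_flip simp del: power_Suc)
  also have "\<dots> = (\<Sum>k | bit i k. dyadic_digit x k) + (if bit i j then 1 else 0)"
    by (simp add: sum.distrib finite_bits_nat)
  finally show ?thesis by (simp add: walsh_def)
qed

text \<open>
  The shift by \<open>1 / 2 ^ Suc j\<close> maps the points with digit \<open>j\<close> equal to \<open>0\<close> onto those with digit \<open>j\<close>
  equal to \<open>1\<close> and preserves Lebesgue measure, so the contributions of the two halves cancel. Both the
  orthogonality of the Walsh functions and the vanishing moments of atoms follow from this.
\<close>

lemma integral_eq_0_if_flip:
  fixes h :: "real \<Rightarrow> real"
  assumes flip: "\<And>x. x \<in> {0..<1} \<Longrightarrow> x + 1 / 2 ^ Suc j \<in> {0..<1} \<Longrightarrow> dyadic_digit x j = 0 \<Longrightarrow>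
    h (x + 1 / 2 ^ Suc j) = - h x"
  shows "(LINT x|unit_leb. h x) = 0"
proof (cases "integrable unit_leb h")
  case True
  define A where "A = {x \<in> {0..<1::real}. dyadic_digit x j = 0}"
  define B where "B = {x \<in> {0..<1::real}. dyadic_digit x j \<noteq> 0}"
  let ?\<delta> = "1 / 2 ^ Suc j :: real"
  have shift: "x + ?\<delta> \<in> B \<longleftrightarrow> x \<in> A" for x
  proof
    assume "x \<in> A"
    then have x: "0 \<le> x" "x < 1" "dyadic_digit x j = 0" by (auto simp: A_def)
    have e: "even \<lfloor>2 ^ Suc j * x\<rfloor>" using x(3) by (simp add: dyadic_digit_def even_iff_mod_2_eq_zero)
    have "\<lfloor>2 ^ Suc j * x\<rfloor> < 2 ^ Suc j" using x(2) by (simp add: floor_less_iff)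
    with e have "\<lfloor>2 ^ Suc j * x\<rfloor> + 1 < 2 ^ Suc j"
      by (metis add.commute dvd_power even_plus_one_iff less_le zero_less_Suc zless_imp_add1_zle)
    then have "2 ^ Suc j * x + 1 < 2 ^ Suc j"
      by (simp add: floor_less_iff flip: less_diff_eq)
    then have "x + ?\<delta> < 1" by (simp add: field_simps)
    then show "x + ?\<delta> \<in> B" using x by (auto simp: B_def dyadic_digit_flip simp del: power_Suc)
  next
    assume "x + ?\<delta> \<in> B"
    then have y: "x + ?\<delta> < 1" "0 \<le> x + ?\<delta>" "dyadic_digit (x + ?\<delta>) j \<noteq> 0" by (auto simp: B_def)
    have fl: "\<lfloor>2 ^ Suc j * (x + ?\<delta>)\<rfloor> = \<lfloor>2 ^ Suc j * x\<rfloor> + 1"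
      by (simp add: distrib_left)
    have "odd (\<lfloor>2 ^ Suc j * x\<rfloor> + 1)"
      using y(3) unfolding dyadic_digit_def fl by (auto simp: even_iff_mod_2_eq_zero)
    then have ev: "even \<lfloor>2 ^ Suc j * x\<rfloor>" by simp
    then have x0: "dyadic_digit x j = 0" unfolding dyadic_digit_def by (simp add: even_iff_mod_2_eq_zero)
    have "0 \<le> \<lfloor>2 ^ Suc j * x\<rfloor> + 1"
      unfolding fl[symmetric] using y(2) by (simp del: power_Suc)
    moreover have "\<lfloor>2 ^ Suc j * x\<rfloor> \<noteq> - 1" using ev by force
    ultimately have "0 \<le> \<lfloor>2 ^ Suc j * x\<rfloor>" by linarith
    then have "0 \<le> x" by (simp add: zero_le_mult_iff power_le_zero_eq)
    moreover have "x < 1" using y(1) by (smt (verit) zero_less_power divide_pos_pos)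
    ultimately show "x \<in> A" using x0 by (simp add: A_def)
  qed
  have hl: "integrable lebesgue (\<lambda>x. indicator {0..<1} x * h x)"
    using True by (simp add: integrable_restrict_space)
  have dig: "{x \<in> {0..<1::real}. dyadic_digit x j = 0} \<in> sets lebesgue"
  proof -
    have "dyadic_step (Suc j) (\<lambda>x. real (dyadic_digit x j))" by (auto simp: dyadic_step_def agree_def)
    then have "(\<lambda>x. real (dyadic_digit x j)) \<in> borel_measurable unit_leb" by (rule measurable_dyadic_step)
    then have "{x \<in> space unit_leb. real (dyadic_digit x j) = 0} \<in> sets unit_leb" by measurable
    then show ?thesis by (subst (asm) sets_restrict_space_iff) auto
  qed
  have A: "A \<in> sets lebesgue" using dig by (simp add: A_def)
  have "B = {0..<1} - A" by (auto simp: A_def B_def)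
  moreover have "{0..<1::real} \<in> sets lebesgue" by simp
  ultimately have B: "B \<in> sets lebesgue" using A by (simp only: sets.Diff)
  have int: "integrable lebesgue (\<lambda>x. indicator C x * h x)" if "C \<in> sets lebesgue" "C \<subseteq> {0..<1}" for C
  proof -
    have "integrable lebesgue (\<lambda>x. indicator C x *\<^sub>R (indicator {0..<1} x * h x))"
      using hl that(1) by (intro integrable_mult_indicator) auto
    moreover have "(\<lambda>x. indicator C x *\<^sub>R (indicator {0..<1} x * h x)) = (\<lambda>x. indicator C x * h x)"
      using that(2) by (intro ext) (auto simp: subset_iff split: split_indicator)
    ultimately show ?thesis by simp
  qed
  have "(LINT x|unit_leb. h x) = (LINT x|lebesgue. indicator {0..<1} x * h x)"
    by (subst integral_restrict_space) auto
  also have "\<dots> = (LINT x|lebesgue. indicator A x * h x + indicator B x * h x)"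
    by (intro Bochner_Integration.integral_cong) (auto simp: A_def B_def indicator_def)
  also have "\<dots> = (LINT x|lebesgue. indicator A x * h x) + (LINT x|lebesgue. indicator B x * h x)"
    using A B by (intro Bochner_Integration.integral_add int) (auto simp: A_def B_def)
  also have "(LINT x|lebesgue. indicator B x * h x)
      = (LINT x|lebesgue. indicator B (?\<delta> + 1 * x) * h (?\<delta> + 1 * x))"
    using lebesgue_integral_real_affine[of 1 "\<lambda>x. indicator B x * h x" ?\<delta>] by simp
  also have "\<dots> = (LINT x|lebesgue. - (indicator A x * h x))"
  proof (intro Bochner_Integration.integral_cong refl)
    fix x
    show "indicator B (?\<delta> + 1 * x) * h (?\<delta> + 1 * x) = - (indicator A x * h x)"
    proof (cases "x \<in> A")
      case True
      then have "x + ?\<delta> \<in> B" by (simp add: shift del: power_Suc)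
      then have "h (x + ?\<delta>) = - h x" using True by (intro flip) (auto simp: A_def B_def simp del: power_Suc)
      then show ?thesis using True \<open>x + ?\<delta> \<in> B\<close> by (simp add: add.commute[of ?\<delta>] del: power_Suc)
    next
      case False
      then have "x + ?\<delta> \<notin> B" by (simp add: shift del: power_Suc)
      then show ?thesis using False by (simp add: add.commute[of ?\<delta>] del: power_Suc)
    qed
  qed
  also have "\<dots> = - (LINT x|lebesgue. indicator A x * h x)" by simp
  finally show ?thesis by simp
qed (rule not_integrable_integral_eq)

lemma walsh_orthonormal: "(LINT x|unit_leb. walsh i x * walsh m x) = (if i = m then 1 else 0)"
proof (cases "i = m")
  case True
  have "walsh m x * walsh m x = 1" for x
    using abs_walsh[of m x] by (metis abs_mult_self_eq mult_1)
  then show ?thesis using True unit_leb.prob_space by (simp)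
next
  case False
  then obtain j where "bit i j \<noteq> bit m j" by (auto simp: bit_eq_iff)
  then show ?thesis using False
    by (subst integral_eq_0_if_flip[of j]) (auto simp: walsh_flip simp del: power_Suc)
qed

section \<open>Powers in the extended non-negative reals\<close>

lemma ennreal_powr_ennreal: "0 \<le> x \<Longrightarrow> ennreal_powr (ennreal x) p = ennreal (x powr p)"
  by (simp add: ennreal_powr_def)

lemma ennreal_powr_top [simp]: "ennreal_powr top p = top"
  by (simp add: ennreal_powr_def infinity_ennreal_def)

lemma ennreal_powr_0 [simp]: "ennreal_powr 0 p = 0"
  using ennreal_powr_ennreal[of 0 p] by simp

lemma ennreal_powr_mono: "0 \<le> p \<Longrightarrow> a \<le> b \<Longrightarrow> ennreal_powr a p \<le> ennreal_powr b p"
  by (cases a; cases b) (auto simp: ennreal_powr_ennreal top_unique intro!: ennreal_leI powr_mono2)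

lemma ennreal_powr_inverse: "0 < p \<Longrightarrow> ennreal_powr (ennreal_powr a p) (1 / p) = a"
  by (cases a) (auto simp: ennreal_powr_ennreal powr_powr)

lemma ennreal_powr_inverse': "0 < p \<Longrightarrow> ennreal_powr (ennreal_powr a (1 / p)) p = a"
  using ennreal_powr_inverse[of "1 / p" a] by simp

lemma ennreal_powr_mult:
  "0 \<le> c \<Longrightarrow> ennreal_powr (ennreal c * a) p = ennreal (c powr p) * ennreal_powr a p"
  by (cases a)
    (auto simp: ennreal_powr_ennreal powr_mult ennreal_mult_top simp flip: ennreal_mult)

text \<open>
  For \<open>p \<le> 1\<close> the factor \<open>(x + y) powr (p - 1)\<close> of \<open>(x + y) powr p\<close> only grows when \<open>x + y\<close> is
  replaced by one of the summands.
\<close>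

lemma powr_add_le:
  fixes x y p :: real
  assumes "0 \<le> x" "0 \<le> y" "0 < p" "p \<le> 1"
  shows "(x + y) powr p \<le> x powr p + y powr p"
proof (cases "x + y = 0")
  case False
  have *: "z * (x + y) powr (p - 1) \<le> z powr p" if "0 \<le> z" "z \<le> x + y" for z
  proof (cases "z = 0")
    case False
    then have "(x + y) powr (p - 1) \<le> z powr (p - 1)"
      using that assms by (intro powr_mono2') auto
    then have "z * (x + y) powr (p - 1) \<le> z * z powr (p - 1)"
      using that by (intro mult_left_mono) auto
    also have "z * z powr (p - 1) = z powr p"
      using that False by (simp add: powr_diff)
    finally show ?thesis .
  qed simp
  have "(x + y) powr p = x * (x + y) powr (p - 1) + y * (x + y) powr (p - 1)"
    using powr_mult_base[of "x + y" "p - 1"] assms by (simp add: distrib_right)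
  then show ?thesis using *[of x] *[of y] assms by simp
qed (use assms in \<open>simp add: add_nonneg_eq_0_iff\<close>)

lemma ennreal_powr_add_le:
  "0 < p \<Longrightarrow> p \<le> 1 \<Longrightarrow> ennreal_powr (a + b) p \<le> ennreal_powr a p + ennreal_powr b p"
  by (cases a; cases b)
    (auto simp: ennreal_powr_ennreal powr_add_le simp flip: ennreal_plus intro!: ennreal_leI)

lemma ennreal_powr_sum_le:
  assumes "0 < p" "p \<le> 1" "finite A"
  shows "ennreal_powr (\<Sum>i\<in>A. f i) p \<le> (\<Sum>i\<in>A. ennreal_powr (f i) p)"
  using assms(3)
  by induction (auto intro: order_trans[OF ennreal_powr_add_le[OF assms(1,2)]] add_left_mono)

text \<open>
  Since \<open>1 / p\<close> undoes the power \<open>p\<close>, this needs monotonicity only: the power \<open>1 / p\<close> of the right-hand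
  side is an upper bound of all \<open>f i\<close>.
\<close>

lemma ennreal_powr_SUP_le:
  assumes "0 < p"
  shows "ennreal_powr (SUP i\<in>I. f i) p \<le> (SUP i\<in>I. ennreal_powr (f i) p)"
proof -
  have "f i \<le> ennreal_powr (SUP i\<in>I. ennreal_powr (f i) p) (1 / p)" if "i \<in> I" for i
    using assms that
    by (subst ennreal_powr_inverse[OF assms, symmetric]) (auto intro!: ennreal_powr_mono SUP_upper)
  then have "ennreal_powr (SUP i\<in>I. f i) p
      \<le> ennreal_powr (ennreal_powr (SUP i\<in>I. ennreal_powr (f i) p) (1 / p)) p"
    using assms by (intro ennreal_powr_mono SUP_least) auto
  then show ?thesis by (simp add: ennreal_powr_inverse'[OF assms])
qed

lemma measurable_ennreal_powr [measurable]:
  assumes [measurable]: "f \<in> borel_measurable M"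
  shows "(\<lambda>x. ennreal_powr (f x) p) \<in> borel_measurable M"
  unfolding ennreal_powr_def infinity_ennreal_def by measurable

lemma Lp_norm_le_iff:
  assumes "0 < p" "0 \<le> c"
  shows "Lp_norm p g \<le> ennreal c * Lp_norm p h \<longleftrightarrow>
    (\<integral>\<^sup>+x. ennreal_powr (g x) p \<partial>unit_leb) \<le> ennreal (c powr p) * (\<integral>\<^sup>+x. ennreal_powr (h x) p \<partial>unit_leb)"
    (is "?l \<longleftrightarrow> ?I \<le> ennreal (c powr p) * ?J")
proof -
  have c: "ennreal c * Lp_norm p h = ennreal_powr (ennreal (c powr p) * ?J) (1 / p)"
    using assms by (simp add: ennreal_powr_mult Lp_norm_def powr_powr)
  show ?thesis
  proof
    assume "?l"
    then have "ennreal_powr (Lp_norm p g) p \<le> ennreal_powr (ennreal c * Lp_norm p h) p"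
      using assms by (intro ennreal_powr_mono) auto
    then show "?I \<le> ennreal (c powr p) * ?J"
      unfolding c unfolding Lp_norm_def by (simp only: ennreal_powr_inverse'[OF assms(1)])
  next
    assume "?I \<le> ennreal (c powr p) * ?J"
    then show ?l unfolding c unfolding Lp_norm_def using assms by (intro ennreal_powr_mono) auto
  qed
qed

section \<open>Walsh coefficients, partial sums and means\<close>

lemma norlund_mean_cong:
  assumes "\<And>i. i < n \<Longrightarrow> walsh_coeff f i = walsh_coeff g i"
  shows "norlund_mean q n f x = norlund_mean q n g x"
  unfolding norlund_mean_def walsh_partial_sum_def using assms by (auto intro!: sum.cong arg_cong2[where f="(/)"])

lemma walsh_coeff_sum:
  assumes "finite A" "\<And>a. a \<in> A \<Longrightarrow> integrable unit_leb (f a)"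
  shows "walsh_coeff (\<lambda>x. \<Sum>a\<in>A. f a x) i = (\<Sum>a\<in>A. walsh_coeff (f a) i)"
  unfolding walsh_coeff_def sum_distrib_right
  using assms by (intro Bochner_Integration.integral_sum integrable_mult_walsh)

lemma integrable_walsh: "integrable unit_leb (walsh i)"
  by (rule integrable_if_bounded[of _ 1]) auto

lemma walsh_coeff_polynomial:
  assumes "finite A"
  shows "walsh_coeff (\<lambda>x. \<Sum>i\<in>A. c i * walsh i x) m = (if m \<in> A then c m else 0)"
proof -
  have "walsh_coeff (\<lambda>x. \<Sum>i\<in>A. c i * walsh i x) m = (\<Sum>i\<in>A. walsh_coeff (\<lambda>x. c i * walsh i x) m)"
    using assms by (intro walsh_coeff_sum) (auto intro: integrable_walsh)
  also have "\<dots> = (\<Sum>i\<in>A. if i = m then c i else 0)"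
    by (intro sum.cong) (auto simp: walsh_coeff_def mult.assoc walsh_orthonormal)
  also have "\<dots> = (if m \<in> A then c m else 0)" using assms by simp
  finally show ?thesis .
qed

lemma walsh_partial_sum_sum:
  assumes "finite A" "\<And>a. a \<in> A \<Longrightarrow> integrable unit_leb (f a)"
  shows "walsh_partial_sum k (\<lambda>x. \<Sum>a\<in>A. f a x) x = (\<Sum>a\<in>A. walsh_partial_sum k (f a) x)"
proof -
  have "walsh_coeff (\<lambda>x. \<Sum>a\<in>A. f a x) i = (\<Sum>a\<in>A. walsh_coeff (f a) i)" for i
    using assms by (rule walsh_coeff_sum)
  then show ?thesis
    unfolding walsh_partial_sum_def by (simp add: sum_distrib_right sum.swap[of _ A])
qed

lemma norlund_mean_sum:
  assumes "finite A" "\<And>a. a \<in> A \<Longrightarrow> integrable unit_leb (f a)"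
  shows "norlund_mean q n (\<lambda>x. \<Sum>a\<in>A. f a x) x = (\<Sum>a\<in>A. norlund_mean q n (f a) x)"
proof -
  have "walsh_partial_sum k (\<lambda>x. \<Sum>a\<in>A. f a x) x = (\<Sum>a\<in>A. walsh_partial_sum k (f a) x)" for k
    using assms by (rule walsh_partial_sum_sum)
  then show ?thesis
    unfolding norlund_mean_def
    by (simp add: sum_distrib_left sum.swap[of _ A] flip: sum_divide_distrib)
qed

lemma dyadic_step_partial_sum: "k \<le> 2 ^ n \<Longrightarrow> dyadic_step n (walsh_partial_sum k f)"
  unfolding dyadic_step_def walsh_partial_sum_def
  by (auto intro!: sum.cong simp: walsh_agree[OF less_le_trans])

lemma measurable_partial_sum [measurable]: "walsh_partial_sum k f \<in> borel_measurable unit_leb"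
  by (rule measurable_dyadic_step[OF dyadic_step_partial_sum[OF less_imp_le[OF less_exp]]])

lemma measurable_norlund_mean [measurable]: "norlund_mean q n f \<in> borel_measurable unit_leb"
  unfolding norlund_mean_def by measurable

lemma measurable_norlund_maximal [measurable]: "norlund_maximal q f \<in> borel_measurable unit_leb"
  unfolding norlund_maximal_def by measurable

lemma measurable_dyadic_maximal [measurable]: "dyadic_maximal f \<in> borel_measurable unit_leb"
  unfolding dyadic_maximal_def by measurable

lemma norlund_mean_eq_integral:
  assumes "integrable unit_leb f"
  shows "norlund_mean q n f x = (LINT t|unit_leb. f t * norlund_kernel q n x t) / Q_sum q n"
proof -
  have S: "walsh_partial_sum k f x = (LINT t|unit_leb. f t * walsh_kernel k x t)"
    and int: "integrable unit_leb (\<lambda>t. f t * walsh_kernel k x t)" for k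
  proof -
    have eq: "f t * walsh_kernel k x t = (\<Sum>i<k. walsh i x * (f t * walsh i t))" for t
      by (simp add: walsh_kernel_def sum_distrib_left ac_simps)
    show "walsh_partial_sum k f x = (LINT t|unit_leb. f t * walsh_kernel k x t)"
      unfolding eq using integrable_mult_walsh[OF assms]
      by (subst Bochner_Integration.integral_sum) (auto simp: walsh_partial_sum_def walsh_coeff_def mult.commute)
    show "integrable unit_leb (\<lambda>t. f t * walsh_kernel k x t)"
      unfolding eq using integrable_mult_walsh[OF assms] by auto
  qed
  have "(LINT t|unit_leb. f t * norlund_kernel q n x t)
      = (LINT t|unit_leb. (\<Sum>k=1..n. q (n - k) * (f t * walsh_kernel k x t)))"
    by (simp add: norlund_kernel_def sum_distrib_left ac_simps)
  also have "\<dots> = (\<Sum>k=1..n. q (n - k) * walsh_partial_sum k f x)"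
    using int by (subst Bochner_Integration.integral_sum) (auto simp: S)
  finally show ?thesis by (simp add: norlund_mean_def)
qed

section \<open>The maximal operator on an atom\<close>

lemma norlund_mean_eq_0:
  assumes "\<And>i. i < n \<Longrightarrow> walsh_coeff f i = 0" shows "norlund_mean q n f x = 0"
  unfolding norlund_mean_def walsh_partial_sum_def using assms by simp

lemma Q_sum_pos: "(\<And>k. q k > 0) \<Longrightarrow> n > 0 \<Longrightarrow> Q_sum q n > 0"
  unfolding Q_sum_def by (intro sum_pos) auto

lemma atom_mean_bound:
  assumes a: "a \<in> borel_measurable unit_leb" "\<And>x. \<bar>a x\<bar> \<le> B" "\<And>x. x \<notin> cell N x0 \<Longrightarrow> a x = 0"
    and x0: "0 \<le> x0" "x0 < 1" and Q: "Q_sum q n > 0"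
    and K: "0 \<le> K" "\<And>t. t \<in> cell N x0 \<Longrightarrow> \<bar>norlund_kernel q n x t\<bar> \<le> K"
  shows "\<bar>norlund_mean q n a x\<bar> \<le> B * K / (2 ^ N * Q_sum q n)"
proof -
  have int: "integrable unit_leb a" by (rule integrable_if_bounded[OF a(1,2)])
  have B: "0 \<le> B" using a(2)[of 0] by linarith
  have [measurable]: "cell N x0 \<in> sets unit_leb" by (rule sets_cell[OF x0])
  have meas: "measure unit_leb (cell N x0) = 1 / 2 ^ N"
    using emeasure_cell[OF x0, of N] by (simp add: measure_def)
  have "\<bar>LINT t|unit_leb. a t * norlund_kernel q n x t\<bar>
      \<le> (LINT t|unit_leb. B * K * indicator (cell N x0) t)"
  proof (rule integral_abs_bound[THEN order_trans], rule integral_mono')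
    show "integrable unit_leb (\<lambda>t. B * K * indicator (cell N x0) t)"
      by (rule integrable_if_bounded[of _ "B * K"])
        (use B K(1) in \<open>auto split: split_indicator\<close>)
    fix t
    show "\<bar>a t * norlund_kernel q n x t\<bar> \<le> B * K * indicator (cell N x0) t"
    proof (cases "t \<in> cell N x0")
      case True
      then show ?thesis using a(2)[of t] K B by (simp add: abs_mult mult_mono)
    qed (simp add: a(3))
  qed (use B K(1) in \<open>auto split: split_indicator\<close>)
  also have "\<dots> = B * K / 2 ^ N"
  proof -
    have "cell N x0 \<inter> {0..<1} = cell N x0" by (auto simp: cell_def)
    then show ?thesis using meas by simp
  qed
  finally show ?thesis
    unfolding norlund_mean_eq_integral[OF int] using Q by (simp add: abs_divide divide_simps mult.commute)
qed

text \<open>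
  The first \<open>2 ^ N\<close> coefficients of the atom vanish, so only means with \<open>n > 2 ^ N\<close> matter, and for these
  \<open>Q_sum q n \<ge> Q_sum q (2 ^ N)\<close>. Every point of the supporting cell shares the digits below \<open>N\<close>
  with \<open>x0\<close>, so the kernel estimates hold with constants that do not depend on the point of the cell.
\<close>

lemma atom_maximal_bound_off_cell:
  assumes q: "decseq q" "\<And>k. q k > 0"
    and a: "a \<in> borel_measurable unit_leb" "\<And>x. \<bar>a x\<bar> \<le> B" "\<And>x. x \<notin> cell N x0 \<Longrightarrow> a x = 0"
      "\<And>i. i < 2 ^ N \<Longrightarrow> walsh_coeff a i = 0"
    and x0: "0 \<le> x0" "x0 < 1"
    and s: "s < N" "dyadic_digit x s \<noteq> dyadic_digit x0 s"
  shows "norlund_maximal q a x \<le> ennreal (B * 2 ^ Suc s / 2 ^ N)"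
    and "s < l \<Longrightarrow> l < N \<Longrightarrow> dyadic_digit x l \<noteq> dyadic_digit x0 l \<Longrightarrow>
      norlund_maximal q a x \<le> ennreal (B * (2 * 2 ^ Suc s * Q_sum q (2 ^ Suc l)) / (2 ^ N * Q_sum q (2 ^ N)))"
proof -
  have B: "0 \<le> B" using a(2)[of 0] by linarith
  have q0: "q k \<ge> 0" for k using q(2)[of k] by simp
  have dig: "dyadic_digit t j = dyadic_digit x0 j" if "t \<in> cell N x0" "j < N" for t j
    using that by (auto simp: cell_def agree_def)
  have Q: "Q_sum q n > 0" if "n \<ge> 1" for n using Q_sum_pos[of q n] q that by auto
  have *: "norlund_maximal q a x \<le> ennreal K"
    if "K \<ge> 0" "\<And>n. n > 2 ^ N \<Longrightarrow> \<bar>norlund_mean q n a x\<bar> \<le> K" for K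
    unfolding norlund_maximal_def
  proof (intro SUP_least ennreal_leI)
    fix n show "\<bar>norlund_mean q n a x\<bar> \<le> K"
    proof (cases "n > 2 ^ N")
      case False
      then have "norlund_mean q n a x = 0" by (intro norlund_mean_eq_0 a(4)) simp
      then show ?thesis using that(1) by simp
    qed (rule that)
  qed
  show "norlund_maximal q a x \<le> ennreal (B * 2 ^ Suc s / 2 ^ N)"
  proof (rule *)
    fix n :: nat assume n: "n > 2 ^ N"
    then have Qn: "Q_sum q n > 0" by (intro Q) simp
    have "\<bar>norlund_mean q n a x\<bar> \<le> B * (2 ^ Suc s * Q_sum q n) / (2 ^ N * Q_sum q n)"
      by (intro atom_mean_bound[OF a(1-3) x0 Qn] norlund_kernel_bound_one_digit q0)
        (use Qn s dig in auto)
    then show "\<bar>norlund_mean q n a x\<bar> \<le> B * 2 ^ Suc s / 2 ^ N" using Qn by simp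
  qed (use B in simp)
  show "norlund_maximal q a x \<le> ennreal (B * (2 * 2 ^ Suc s * Q_sum q (2 ^ Suc l)) / (2 ^ N * Q_sum q (2 ^ N)))"
    if l: "s < l" "l < N" "dyadic_digit x l \<noteq> dyadic_digit x0 l"
  proof (rule *)
    fix n :: nat assume n: "n > 2 ^ N"
    then have Qn: "Q_sum q n > 0" by (intro Q) simp
    have num: "0 \<le> 2 * 2 ^ Suc s * Q_sum q (2 ^ Suc l)" using Q[of "2 ^ Suc l"] by simp
    have "\<bar>norlund_mean q n a x\<bar> \<le> B * (2 * 2 ^ Suc s * Q_sum q (2 ^ Suc l)) / (2 ^ N * Q_sum q n)"
      by (intro atom_mean_bound[OF a(1-3) x0 Qn num] norlund_kernel_bound_two_digits q q0)
        (use s l dig in auto)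
    also have "\<dots> \<le> B * (2 * 2 ^ Suc s * Q_sum q (2 ^ Suc l)) / (2 ^ N * Q_sum q (2 ^ N))"
      using n Q[of "2 ^ N"] Qn
      by (intro divide_left_mono mult_nonneg_nonneg[OF B num] mult_left_mono Q_sum_mono mult_pos_pos) (auto simp: q0)
    finally show "\<bar>norlund_mean q n a x\<bar> \<le> \<dots>" .
  qed (use B Q[of "2 ^ N"] Q[of "2 ^ Suc l"] in simp)
qed

lemma atom_maximal_bound_AE:
  assumes bdd: "\<And>f. f \<in> Linf_space \<Longrightarrow> Linf_norm (norlund_maximal q f)
      \<le> ennreal c * Linf_norm (\<lambda>x. ennreal \<bar>f x\<bar>)"
    and a: "a \<in> borel_measurable unit_leb" "\<And>x. \<bar>a x\<bar> \<le> B" and c: "0 \<le> c"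
  shows "AE x in unit_leb. norlund_maximal q a x \<le> ennreal (c * B)"
proof -
  have B: "0 \<le> B" using a(2)[of 0] by linarith
  have le: "Linf_norm (\<lambda>x. ennreal \<bar>a x\<bar>) \<le> ennreal B"
    unfolding Linf_norm_def using a by (intro esssup_I AE_I2 ennreal_leI) auto
  then have "a \<in> Linf_space"
    using a(1) by (auto simp: Linf_space_def infinity_ennreal_def intro: le_less_trans)
  from bdd[OF this] le have "Linf_norm (norlund_maximal q a) \<le> ennreal c * ennreal B"
    by (meson mult_left_mono order_trans zero_le)
  then have "esssup unit_leb (norlund_maximal q a) \<le> ennreal (c * B)"
    using c B by (simp add: Linf_norm_def ennreal_mult)
  then show ?thesis
    using esssup_AE[of "norlund_maximal q a" unit_leb] by (auto elim!: eventually_mono)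
qed

lemma sum_geometric_le:
  fixes r :: real assumes "r > 1"
  shows "(\<Sum>s<l. r ^ Suc s) \<le> r / (r - 1) * r ^ l"
proof (induction l)
  case (Suc l)
  have "r / (r - 1) * r ^ l + r ^ Suc l = r / (r - 1) * r ^ Suc l"
    using assms by (simp add: field_simps)
  then show ?case using Suc.IH by simp
qed (use assms in simp)

lemma power2_powr: "(2 ^ k :: real) powr p = (2 powr p) ^ k"
  by (simp add: powr_power powr_powr mult.commute flip: powr_realpow)

text \<open>
  The summand is the \<open>p\<close>-th power of the bound for points that differ from the cell in the single digit
  \<open>s\<close>. Those points form a set of measure \<open>1 / 2 ^ N\<close>, a factor left out here.
\<close>

lemma off_cell_one_digit_sum:
  fixes B p :: real assumes "0 < p" "0 \<le> B"
  shows "(\<Sum>s<N. (B * 2 ^ Suc s / 2 ^ N) powr p) \<le> 2 powr p / (2 powr p - 1) * B powr p"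
proof -
  have r: "2 powr p > 1" using assms by simp
  have "(B * 2 ^ Suc s / 2 ^ N) powr p = B powr p / (2 powr p) ^ N * (2 powr p) ^ Suc s" for s
    using assms unfolding power2_powr[symmetric] by (simp add: powr_mult powr_divide)
  then have "(\<Sum>s<N. (B * 2 ^ Suc s / 2 ^ N) powr p) = B powr p / (2 powr p) ^ N * (\<Sum>s<N. (2 powr p) ^ Suc s)"
    by (simp add: sum_distrib_left)
  also have "\<dots> \<le> B powr p / (2 powr p) ^ N * (2 powr p / (2 powr p - 1) * (2 powr p) ^ N)"
    by (intro mult_left_mono sum_geometric_le[OF r]) simp
  also have "\<dots> = 2 powr p / (2 powr p - 1) * B powr p" by simp
  finally show ?thesis .
qed

text \<open>
  Here \<open>s < l\<close> are the first two digits in which a point differs from the cell, and \<open>1 / 2 ^ Suc l\<close> is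
  the measure of the set of such points. The geometric sum over \<open>s\<close> leaves a sum over \<open>l\<close>, which with
  \<open>j = Suc l\<close> is the sum in the condition of the theorem.
\<close>

lemma off_cell_two_digits_sum:
  fixes B p :: real and R :: "nat \<Rightarrow> real"
  assumes "0 < p" "0 \<le> B" and R: "\<And>j. R j > 0"
  shows "(\<Sum>l<N. \<Sum>s<l. (B * (2 * 2 ^ Suc s * R (Suc l)) / (2 ^ N * R N)) powr p / 2 ^ Suc l)
    \<le> 2 powr p / (2 powr p - 1) * B powr p / 2 ^ N
      * (2 powr (real N * (1 - p)) / R N powr p * (\<Sum>j=1..N. R j powr p * 2 powr (real j * (p - 1))))"
proof -
  define r where "r = 2 powr p"
  have r: "r > 1" using assms by (simp add: r_def)
  have pw: "2 powr (real j * (p - 1)) = r ^ j / 2 ^ j" for j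
    by (simp add: r_def right_diff_distrib powr_diff powr_power powr_realpow mult.commute)
  have pw': "2 powr (real N * (1 - p)) = 2 ^ N / r ^ N"
    by (simp add: r_def right_diff_distrib powr_diff powr_power powr_realpow mult.commute)
  have "(\<Sum>l<N. \<Sum>s<l. (B * (2 * 2 ^ Suc s * R (Suc l)) / (2 ^ N * R N)) powr p / 2 ^ Suc l)
      = (\<Sum>l<N. r * B powr p * R (Suc l) powr p / (r ^ N * R N powr p) / 2 ^ Suc l * (\<Sum>s<l. r ^ Suc s))"
    unfolding sum_distrib_left r_def power2_powr[symmetric]
    using assms(1,2) R[THEN less_imp_le]
    by (intro sum.cong refl) (simp add: powr_mult powr_divide del: power_Suc)
  also have "\<dots> \<le> (\<Sum>l<N. r * B powr p * R (Suc l) powr p / (r ^ N * R N powr p) / 2 ^ Suc l * (r / (r - 1) * r ^ l))"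
    using r by (intro sum_mono mult_left_mono sum_geometric_le) auto
  also have "\<dots> = (\<Sum>l<N. r / (r - 1) * B powr p / (r ^ N * R N powr p) * (R (Suc l) powr p * (r ^ Suc l / 2 ^ Suc l)))"
    by (intro sum.cong refl) (simp add: field_simps)
  also have "\<dots> = r / (r - 1) * B powr p / (r ^ N * R N powr p) * (\<Sum>j=1..N. R j powr p * (r ^ j / 2 ^ j))"
    unfolding sum_distrib_left[symmetric]
    by (intro arg_cong2[where f = "(*)"] refl sum.reindex_bij_witness[of _ "\<lambda>k. k - 1" Suc]) auto
  also have "\<dots> = r / (r - 1) * B powr p / 2 ^ N * (2 ^ N / r ^ N / R N powr p * (\<Sum>j=1..N. R j powr p * (r ^ j / 2 ^ j)))"
    by simp
  finally show ?thesis unfolding pw pw' r_def .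
qed

text \<open>
  On the cell the boundedness on \<open>L\<^sub>\<infinity>\<close> gives the bound \<open>c * B\<close>. The complement of the cell is divided
  according to the first digit \<open>s\<close> and, if there is one below \<open>N\<close>, the second digit \<open>l\<close> in which a point
  differs from the cell. The pieces with a second digit add up to the condition of the theorem, those
  without one to a constant.
\<close>

lemma atom_estimate:
  fixes p A c :: real
  assumes q: "decseq q" "\<And>k. q k > 0" and p: "0 < p"
    and bdd: "\<And>f. f \<in> Linf_space \<Longrightarrow> Linf_norm (norlund_maximal q f)
      \<le> ennreal c * Linf_norm (\<lambda>x. ennreal \<bar>f x\<bar>)" and c: "0 \<le> c"
    and A: "2 powr (real N * (1 - p)) / Q_sum q (2 ^ N) powr p
            * (\<Sum>j=1..N. Q_sum q (2 ^ j) powr p * 2 powr (real j * (p - 1))) \<le> A"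
    and a: "a \<in> borel_measurable unit_leb" "\<And>x. \<bar>a x\<bar> \<le> B" "\<And>x. x \<notin> cell N x0 \<Longrightarrow> a x = 0"
      "\<And>i. i < 2 ^ N \<Longrightarrow> walsh_coeff a i = 0"
    and x0: "0 \<le> x0" "x0 < 1"
  shows "(\<integral>\<^sup>+x. ennreal_powr (norlund_maximal q a x) p \<partial>unit_leb)
    \<le> ennreal ((c powr p + 2 powr p / (2 powr p - 1) * (A + 1)) * B powr p / 2 ^ N)"
proof -
  have B: "0 \<le> B" using a(2)[of 0] by linarith
  have Q: "Q_sum q (2 ^ n) > 0" for n using Q_sum_pos[of q "2 ^ n"] q by auto
  let ?C = "2 powr p / (2 powr p - 1) :: real"
  have "2 powr p > (1::real)" using p by simp
  then have C: "?C \<ge> 0" by simp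
  \<comment> \<open>\<open>E1 s\<close>: digit \<open>s\<close> is the only one below \<open>N\<close> that differs. \<open>E2 l s\<close>: the first two differing digits are \<open>s < l\<close>.\<close>
  define E1 where "E1 s = {y \<in> {0..<1}. \<forall>j<N. dyadic_digit y j
      = (if j = s then 1 - dyadic_digit x0 j else dyadic_digit x0 j)}" for s
  define E2 where "E2 l s = {y \<in> {0..<1}. \<forall>j<Suc l. dyadic_digit y j
      = (if j = s \<or> j = l then 1 - dyadic_digit x0 j else dyadic_digit x0 j)}" for l s
  define k1 where "k1 s = B * 2 ^ Suc s / 2 ^ N" for s :: nat
  define k2 where "k2 l s = B * (2 * 2 ^ Suc s * Q_sum q (2 ^ Suc l)) / (2 ^ N * Q_sum q (2 ^ N))" for l s :: nat
  have k1: "0 \<le> k1 s" for s using B by (simp add: k1_def)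
  have k2: "0 \<le> k2 l s" for l s using B Q[of N] Q[of "Suc l"] by (simp add: k2_def)
  have [measurable]: "E1 s \<in> sets unit_leb" "E2 l s \<in> sets unit_leb" "cell N x0 \<in> sets unit_leb" for l s
    unfolding E1_def E2_def using digit_pattern_set sets_cell[OF x0] by auto
  have E1: "emeasure unit_leb (E1 s) \<le> ennreal (1 / 2 ^ N)" for s
    unfolding E1_def by (rule digit_pattern_set[THEN conjunct2])
  have E2: "emeasure unit_leb (E2 l s) \<le> ennreal (1 / 2 ^ Suc l)" for l s
    unfolding E2_def by (rule digit_pattern_set[THEN conjunct2])
  let ?G = "\<lambda>x. ennreal ((c * B) powr p) * indicator (cell N x0) x
    + (\<Sum>l<N. \<Sum>s<l. ennreal (k2 l s powr p) * indicator (E2 l s) x)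
    + (\<Sum>s<N. ennreal (k1 s powr p) * indicator (E1 s) x)"
  have opp: "dyadic_digit x j = 1 - dyadic_digit x0 j" if "dyadic_digit x j \<noteq> dyadic_digit x0 j" for x j
    using that dyadic_digit_le_1[of x j] dyadic_digit_le_1[of x0 j] by (auto simp: le_Suc_eq)
  have bound: "ennreal_powr (norlund_maximal q a x) p \<le> ?G x"
    if x: "x \<in> {0..<1}" and AE: "norlund_maximal q a x \<le> ennreal (c * B)" for x
  proof (cases "x \<in> cell N x0")
    case True
    have "ennreal_powr (norlund_maximal q a x) p \<le> ennreal_powr (ennreal (c * B)) p"
      using AE p by (intro ennreal_powr_mono) auto
    also have "\<dots> = ennreal ((c * B) powr p) * indicator (cell N x0) x"
      using True B c by (simp add: ennreal_powr_ennreal)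
    also have "\<dots> \<le> ?G x" by (simp add: add.assoc add_increasing2)
    finally show ?thesis .
  next
    case False
    \<comment> \<open>\<open>s\<close> and, below, \<open>l\<close> are the first and the second digit in which \<open>x\<close> leaves the cell.\<close>
    define s where "s = (LEAST j. dyadic_digit x j \<noteq> dyadic_digit x0 j)"
    have "\<not> agree N x0 x" using False x by (simp add: cell_def)
    then obtain j where j: "j < N" "dyadic_digit x j \<noteq> dyadic_digit x0 j"
      unfolding agree_def by metis
    have s: "dyadic_digit x s \<noteq> dyadic_digit x0 s" unfolding s_def by (rule LeastI[of _ j]) (rule j)
    have "s \<le> j" unfolding s_def by (rule Least_le) (rule j)
    then have sN: "s < N" using j by simp
    have below: "dyadic_digit x i = dyadic_digit x0 i" if "i < s" for i
      using not_less_Least[OF that[unfolded s_def]] by simp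
    have max1: "norlund_maximal q a x \<le> ennreal (k1 s)"
      unfolding k1_def by (rule atom_maximal_bound_off_cell; fact)
    show ?thesis
    proof (cases "\<exists>l. s < l \<and> l < N \<and> dyadic_digit x l \<noteq> dyadic_digit x0 l")
      case False
      then have "\<forall>j<N. j \<noteq> s \<longrightarrow> dyadic_digit x j = dyadic_digit x0 j"
        using below by (metis linorder_neqE_nat)
      then have "x \<in> E1 s"
        unfolding E1_def using x opp[OF s] by simp
      have "ennreal_powr (norlund_maximal q a x) p \<le> ennreal_powr (ennreal (k1 s)) p"
        using max1 p by (intro ennreal_powr_mono) auto
      also have "\<dots> = ennreal (k1 s powr p) * indicator (E1 s) x"
        using \<open>x \<in> E1 s\<close> k1 by (simp add: ennreal_powr_ennreal)
      also have "\<dots> \<le> (\<Sum>s<N. ennreal (k1 s powr p) * indicator (E1 s) x)"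
        using sN by (intro member_le_sum) auto
      also have "\<dots> \<le> ?G x" by (simp add: add_increasing)
      finally show ?thesis .
    next
      case True
      define l where "l = (LEAST l. s < l \<and> l < N \<and> dyadic_digit x l \<noteq> dyadic_digit x0 l)"
      have l: "s < l" "l < N" "dyadic_digit x l \<noteq> dyadic_digit x0 l"
        using LeastI_ex[OF True] unfolding l_def by auto
      have between: "dyadic_digit x i = dyadic_digit x0 i" if "s < i" "i < l" for i
        using not_less_Least[OF that(2)[unfolded l_def]] that l by auto
      have "\<forall>j<Suc l. j \<noteq> s \<longrightarrow> j \<noteq> l \<longrightarrow> dyadic_digit x j = dyadic_digit x0 j"
        using below between by (metis linorder_neqE_nat less_SucE)
      then have "x \<in> E2 l s"
        unfolding E2_def using x opp[OF s] opp[OF l(3)] by simp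
      have "norlund_maximal q a x \<le> ennreal (k2 l s)"
        unfolding k2_def by (rule atom_maximal_bound_off_cell(2); fact)
      then have "ennreal_powr (norlund_maximal q a x) p \<le> ennreal_powr (ennreal (k2 l s)) p"
        using p by (intro ennreal_powr_mono) auto
      also have "\<dots> = ennreal (k2 l s powr p) * indicator (E2 l s) x"
        using \<open>x \<in> E2 l s\<close> k2 by (simp add: ennreal_powr_ennreal)
      also have "\<dots> \<le> (\<Sum>s<l. ennreal (k2 l s powr p) * indicator (E2 l s) x)"
        using l by (intro member_le_sum) auto
      also have "\<dots> \<le> (\<Sum>l<N. \<Sum>s<l. ennreal (k2 l s powr p) * indicator (E2 l s) x)"
        using l by (intro member_le_sum[of l "{..<N}" "\<lambda>l. \<Sum>s<l. ennreal (k2 l s powr p) * indicator (E2 l s) x"]) auto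
      also have "\<dots> \<le> ?G x" by (simp add: add_increasing add_increasing2)
      finally show ?thesis .
    qed
  qed
  have on_cell: "AE x in unit_leb. norlund_maximal q a x \<le> ennreal (c * B)"
    by (rule atom_maximal_bound_AE; fact)
  have "(\<integral>\<^sup>+x. ennreal_powr (norlund_maximal q a x) p \<partial>unit_leb) \<le> (\<integral>\<^sup>+x. ?G x \<partial>unit_leb)"
  proof (rule nn_integral_mono_AE)
    show "AE x in unit_leb. ennreal_powr (norlund_maximal q a x) p \<le> ?G x"
      using on_cell AE_space[of unit_leb] by eventually_elim (rule bound, simp_all)
  qed
  also have "\<dots> = ennreal ((c * B) powr p) * emeasure unit_leb (cell N x0)
      + (\<Sum>l<N. \<Sum>s<l. ennreal (k2 l s powr p) * emeasure unit_leb (E2 l s))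
      + (\<Sum>s<N. ennreal (k1 s powr p) * emeasure unit_leb (E1 s))"
  proof -
    have int: "(\<integral>\<^sup>+x. (\<Sum>i\<in>I. ennreal (k i) * indicator (E i) x) \<partial>unit_leb)
        = (\<Sum>i\<in>I. ennreal (k i) * emeasure unit_leb (E i))"
      if "\<And>i. E i \<in> sets unit_leb" for k :: "nat \<Rightarrow> real" and E I
      using that by (subst nn_integral_sum) (auto intro!: sum.cong nn_integral_cmult_indicator)
    show ?thesis
      by (subst nn_integral_add, measurable, subst nn_integral_add, measurable,
        subst nn_integral_sum, measurable)
        (simp only: int \<open>\<And>s. E1 s \<in> sets unit_leb\<close> \<open>\<And>l s. E2 l s \<in> sets unit_leb\<close>
          nn_integral_cmult_indicator \<open>cell N x0 \<in> sets unit_leb\<close>)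
  qed
  also have "\<dots> \<le> ennreal ((c * B) powr p) * ennreal (1 / 2 ^ N)
      + (\<Sum>l<N. \<Sum>s<l. ennreal (k2 l s powr p) * ennreal (1 / 2 ^ Suc l))
      + (\<Sum>s<N. ennreal (k1 s powr p) * ennreal (1 / 2 ^ N))"
    using E1 E2 emeasure_cell[OF x0] by (intro add_mono sum_mono mult_left_mono) auto
  also have "\<dots> = ennreal ((c * B) powr p / 2 ^ N + (\<Sum>l<N. \<Sum>s<l. k2 l s powr p / 2 ^ Suc l)
      + (\<Sum>s<N. k1 s powr p) / 2 ^ N)"
    by (simp add: sum_nonneg sum_divide_distrib flip: ennreal_mult ennreal_plus del: power_Suc)
  also have "\<dots> \<le> ennreal (c powr p * B powr p / 2 ^ N + ?C * B powr p / 2 ^ N * A + ?C * B powr p / 2 ^ N)"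
  proof (intro ennreal_leI add_mono)
    show "(c * B) powr p / 2 ^ N \<le> c powr p * B powr p / 2 ^ N"
      using c B by (simp add: powr_mult)
    show "(\<Sum>s<N. k1 s powr p) / 2 ^ N \<le> ?C * B powr p / 2 ^ N"
      unfolding k1_def by (rule divide_right_mono[OF off_cell_one_digit_sum[OF p B]]) simp
    have "(\<Sum>l<N. \<Sum>s<l. k2 l s powr p / 2 ^ Suc l) \<le> ?C * B powr p / 2 ^ N *
      (2 powr (real N * (1 - p)) / Q_sum q (2 ^ N) powr p
            * (\<Sum>j=1..N. Q_sum q (2 ^ j) powr p * 2 powr (real j * (p - 1))))"
      unfolding k2_def using off_cell_two_digits_sum[OF p B, of "\<lambda>j. Q_sum q (2 ^ j)" N] Q by simp
    also have "\<dots> \<le> ?C * B powr p / 2 ^ N * A"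
      by (intro mult_left_mono A divide_nonneg_nonneg mult_nonneg_nonneg C) simp_all
    finally show "(\<Sum>l<N. \<Sum>s<l. k2 l s powr p / 2 ^ Suc l) \<le> \<dots>" .
  qed
  also have "c powr p * B powr p / 2 ^ N + ?C * B powr p / 2 ^ N * A + ?C * B powr p / 2 ^ N
      = (c powr p + ?C * (A + 1)) * B powr p / 2 ^ N"
    by (simp add: algebra_simps add_divide_distrib)
  finally show ?thesis .
qed

section \<open>Necessity: testing on Walsh blocks\<close>

lemma Q_sum_double: "decseq q \<Longrightarrow> Q_sum q (2 * h) \<le> 2 * Q_sum q h"
  unfolding Q_sum_def mult_2 sum_lessThan_add
  by (simp add: sum_mono decseq_def)

text \<open>
  The larger half of the indices \<open>m\<close> carries the larger half of the weights.
\<close>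

lemma weighted_identity_lower_bound:
  assumes q: "decseq q" "\<And>k. q k > 0"
  shows "real h / 2 * Q_sum q (2 * h) \<le> (\<Sum>m=1..2 * h. q (2 * h - m) * real m)"
proof -
  have "real h / 2 * Q_sum q (2 * h) \<le> real h * Q_sum q h"
    using mult_left_mono[OF Q_sum_double[OF q(1), of h], of "real h / 2"] by simp
  also have "Q_sum q h = (\<Sum>m\<in>{Suc h..2 * h}. q (2 * h - m))"
    unfolding Q_sum_def
    by (rule sum.reindex_bij_witness[of _ "\<lambda>m. 2 * h - m" "\<lambda>k. 2 * h - k"]) auto
  also have "real h * \<dots> = (\<Sum>m\<in>{Suc h..2 * h}. q (2 * h - m) * real h)"
    by (simp add: sum_distrib_left mult.commute)
  also have "\<dots> \<le> (\<Sum>m\<in>{Suc h..2 * h}. q (2 * h - m) * real m)"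
    using q(2)[THEN less_imp_le] by (intro sum_mono mult_left_mono) auto
  also have "\<dots> \<le> (\<Sum>m=1..2 * h. q (2 * h - m) * real m)"
    using q(2)[THEN less_imp_le] by (intro sum_mono2) auto
  finally show ?thesis .
qed

text \<open>
  The difference of the Dirichlet kernels of orders \<open>2 ^ Suc N\<close> and \<open>2 ^ N\<close>: its maximal function is
  its own absolute value, concentrated on \<open>[0, 1 / 2 ^ N)\<close>, whereas its means of order slightly above
  \<open>2 ^ N\<close> spread far beyond that interval.
\<close>

definition walsh_block :: "nat \<Rightarrow> real \<Rightarrow> real" where
  "walsh_block N x = (\<Sum>i\<in>{2 ^ N..<2 ^ Suc N}. walsh i x)"

lemma walsh_coeff_block: "walsh_coeff (walsh_block N) i = (if i \<in> {2 ^ N..<2 ^ Suc N} then 1 else 0)"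
proof -
  have "walsh_block N = (\<lambda>x. \<Sum>i\<in>{2 ^ N..<2 ^ Suc N}. 1 * walsh i x)"
    by (simp add: walsh_block_def fun_eq_iff)
  then show ?thesis using walsh_coeff_polynomial[of "{2 ^ N..<2 ^ Suc N}" "\<lambda>_. 1" i] by simp
qed

lemma walsh_power_add: "m < 2 ^ N \<Longrightarrow> walsh (2 ^ N + m) x = (-1) ^ dyadic_digit x N * walsh m x"
  using walsh_add_power[of m N x] bit_imp_less[of m N N] by (auto simp: add.commute)

lemma partial_sum_walsh_block:
  "k \<le> 2 ^ N \<Longrightarrow> walsh_partial_sum k (walsh_block N) x = 0"
  "m \<le> 2 ^ N \<Longrightarrow> walsh_partial_sum (2 ^ N + m) (walsh_block N) x
    = (-1) ^ dyadic_digit x N * (\<Sum>i<m. walsh i x)"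
  "2 ^ Suc N \<le> k \<Longrightarrow> walsh_partial_sum k (walsh_block N) x = walsh_block N x"
proof -
  show small: "walsh_partial_sum k (walsh_block N) x = 0" if "k \<le> 2 ^ N" for k
    using that by (auto simp: walsh_partial_sum_def walsh_coeff_block)
  show "walsh_partial_sum (2 ^ N + m) (walsh_block N) x
    = (-1) ^ dyadic_digit x N * (\<Sum>i<m. walsh i x)" if "m \<le> 2 ^ N"
    using small[of "2 ^ N"] that unfolding walsh_partial_sum_def
    by (auto simp: sum_lessThan_add walsh_coeff_block walsh_power_add sum_distrib_left intro!: sum.cong)
  show "walsh_partial_sum k (walsh_block N) x = walsh_block N x" if "2 ^ Suc N \<le> k"
  proof -
    have "walsh_partial_sum k (walsh_block N) x
        = (\<Sum>i<k. if i \<in> {2 ^ N..<2 ^ Suc N} then walsh i x else 0)"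
      unfolding walsh_partial_sum_def walsh_coeff_block by (intro sum.cong) auto
    also have "\<dots> = (\<Sum>i\<in>{i \<in> {..<k}. i \<in> {2 ^ N..<2 ^ Suc N}}. walsh i x)"
      by (rule sum.inter_filter[symmetric]) simp
    also have "{i \<in> {..<k}. i \<in> {2 ^ N..<2 ^ Suc N}} = {2 ^ N..<2 ^ Suc N}"
      using that by auto
    finally show ?thesis unfolding walsh_block_def[of N x] .
  qed
qed

lemma walsh_at_0 [simp]: "walsh i 0 = 1"
  by (simp add: walsh_def dyadic_digit_def)

lemma abs_walsh_block_le:
  assumes "0 \<le> x" "x < 1"
  shows "\<bar>walsh_block N x\<bar> \<le> 2 ^ N * indicator (cell N 0) x"
proof -
  have "walsh_block N x = walsh_partial_sum (2 ^ N + 2 ^ N) (walsh_block N) x"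
    by (subst partial_sum_walsh_block(3)) auto
  also have "\<dots> = (-1) ^ dyadic_digit x N * (\<Sum>i<2 ^ N. walsh i x)"
    by (rule partial_sum_walsh_block(2)) simp
  finally have eq: "\<bar>walsh_block N x\<bar> = \<bar>\<Sum>i<2 ^ N. walsh i x\<bar>"
    by (simp add: abs_mult power_abs)
  show ?thesis
  proof (cases "agree N 0 x")
    case True
    have "\<bar>\<Sum>i<2 ^ N. walsh i x\<bar> \<le> (\<Sum>i<2 ^ N :: nat. 1)"
      by (rule order_trans[OF sum_abs]) simp
    then show ?thesis using True assms by (simp add: eq cell_def)
  next
    case False
    then obtain s where s: "s < N" "dyadic_digit x s \<noteq> dyadic_digit 0 s"
      by (auto simp: agree_def eq_commute)
    have "(\<Sum>i<2 ^ N. walsh i x) = 0"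
      using walsh_kernel_power_eq_0[OF s(2,1), of 1] by (simp add: walsh_kernel_def)
    then show ?thesis by (simp add: eq)
  qed
qed

lemma dyadic_maximal_walsh_block: "dyadic_maximal (walsh_block N) x \<le> ennreal \<bar>walsh_block N x\<bar>"
  unfolding dyadic_maximal_def
proof (intro SUP_least ennreal_leI)
  fix n :: nat
  consider "n \<le> N" | "Suc N \<le> n" by linarith
  then show "\<bar>walsh_partial_sum (2 ^ n) (walsh_block N) x\<bar> \<le> \<bar>walsh_block N x\<bar>"
  proof cases
    assume "n \<le> N"
    then have "(2::nat) ^ n \<le> 2 ^ N" by simp
    then show ?thesis by (simp only: partial_sum_walsh_block(1))
  next
    assume "Suc N \<le> n"
    then have "(2::nat) ^ Suc N \<le> 2 ^ n" by (intro power_increasing) auto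
    then show ?thesis by (simp only: partial_sum_walsh_block(3))
  qed
qed

lemma Hp_integral_walsh_block:
  assumes "0 < p"
  shows "(\<integral>\<^sup>+x. ennreal_powr (dyadic_maximal (walsh_block N) x) p \<partial>unit_leb)
    \<le> ennreal (2 powr (real N * (p - 1)))"
proof -
  have "(\<integral>\<^sup>+x. ennreal_powr (dyadic_maximal (walsh_block N) x) p \<partial>unit_leb)
      \<le> (\<integral>\<^sup>+x. ennreal ((2 ^ N) powr p) * indicator (cell N 0) x \<partial>unit_leb)"
  proof (rule nn_integral_mono)
    fix x assume "x \<in> space unit_leb"
    then have "ennreal \<bar>walsh_block N x\<bar> \<le> ennreal (2 ^ N * indicator (cell N 0) x)"
      by (intro ennreal_leI abs_walsh_block_le) auto
    then have "ennreal_powr (dyadic_maximal (walsh_block N) x) p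
        \<le> ennreal_powr (ennreal (2 ^ N * indicator (cell N 0) x)) p"
      using assms by (intro ennreal_powr_mono order_trans[OF dyadic_maximal_walsh_block]) auto
    also have "\<dots> = ennreal ((2 ^ N) powr p) * indicator (cell N 0) x"
      by (subst ennreal_powr_ennreal) (auto split: split_indicator)
    finally show "ennreal_powr (dyadic_maximal (walsh_block N) x) p \<le> \<dots>" .
  qed
  also have "\<dots> = ennreal ((2 ^ N) powr p) * ennreal (1 / 2 ^ N)"
    by (subst nn_integral_cmult_indicator) (auto simp: sets_cell emeasure_cell)
  also have "\<dots> = ennreal (2 powr (real N * (p - 1)))"
    by (simp add: right_diff_distrib powr_diff power2_powr powr_power powr_realpow mult.commute flip: ennreal_mult)
  finally show ?thesis .
qed

lemma walsh_block_in_Hp_space: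
  assumes "0 < p" shows "walsh_block N \<in> Hp_space p"
proof -
  have "integrable unit_leb (walsh_block N)"
    unfolding walsh_block_def by (intro Bochner_Integration.integrable_sum integrable_walsh)
  moreover have "(\<integral>\<^sup>+x. ennreal_powr (dyadic_maximal (walsh_block N) x) p \<partial>unit_leb) < \<infinity>"
    using Hp_integral_walsh_block[OF assms, of N] by (simp add: le_less_trans)
  then have "Hp_norm p (walsh_block N) < \<infinity>"
    by (auto simp: Hp_norm_def Lp_norm_def ennreal_powr_def)
  ultimately show ?thesis by (simp add: Hp_space_def)
qed

text \<open>
  The mean of order \<open>2 ^ N + 2 ^ j\<close> is the witness. On the cell of \<open>0\<close> of level \<open>j\<close> the partial sum of
  order \<open>2 ^ N + m\<close> with \<open>m \<le> 2 ^ j\<close> adds \<open>m\<close> equal terms \<open>1\<close> or \<open>m\<close> equal terms \<open>-1\<close>, so nothing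
  cancels.
\<close>

lemma norlund_maximal_walsh_block_ge:
  assumes q: "decseq q" "\<And>k. q k > 0" and j: "1 \<le> j" "j \<le> N" and x: "agree j 0 x"
  shows "ennreal (2 ^ j * Q_sum q (2 ^ j) / (8 * Q_sum q (2 ^ N))) \<le> norlund_maximal q (walsh_block N) x"
proof -
  let ?n = "2 ^ N + 2 ^ j :: nat"
  have q0: "q k \<ge> 0" for k using q(2)[of k] by simp
  have Qpos: "Q_sum q n > 0" if "n > 0" for n using Q_sum_pos[OF q(2) that] .
  have one: "walsh i x = 1" if "i < 2 ^ j" for i
    using walsh_agree[OF that x] by simp
  have jN: "(2::nat) ^ j \<le> 2 ^ N" using j by simp
  have "(\<Sum>k=1..?n. q (?n - k) * walsh_partial_sum k (walsh_block N) x)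
      = (\<Sum>k\<in>{Suc (2 ^ N)..?n}. q (?n - k) * walsh_partial_sum k (walsh_block N) x)"
    by (rule sum.mono_neutral_right) (auto simp: partial_sum_walsh_block(1))
  also have "\<dots> = (\<Sum>m=1..2 ^ j. q (2 ^ j - m) * walsh_partial_sum (2 ^ N + m) (walsh_block N) x)"
    by (rule sum.reindex_bij_witness[of _ "\<lambda>m. 2 ^ N + m" "\<lambda>k. k - 2 ^ N"])
      (auto simp: add.commute[of "2 ^ j" "2 ^ N"])
  also have "\<dots> = (\<Sum>m=1..2 ^ j. (-1) ^ dyadic_digit x N * (q (2 ^ j - m) * real m))"
  proof (intro sum.cong refl)
    fix m :: nat assume m: "m \<in> {1..2 ^ j}"
    then have "m \<le> 2 ^ N" using order_trans[OF _ jN] by simp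
    moreover have "(\<Sum>i<m. walsh i x) = real m" using m one by simp
    ultimately show "q (2 ^ j - m) * walsh_partial_sum (2 ^ N + m) (walsh_block N) x
        = (-1) ^ dyadic_digit x N * (q (2 ^ j - m) * real m)"
      by (simp add: partial_sum_walsh_block(2))
  qed
  finally have eq: "\<bar>norlund_mean q ?n (walsh_block N) x\<bar>
      = (\<Sum>m=1..2 ^ j. q (2 ^ j - m) * real m) / Q_sum q ?n"
    using Qpos[of ?n] q0
    by (simp add: norlund_mean_def abs_mult power_abs sum_nonneg flip: sum_distrib_left)
  have "(2::nat) ^ j = 2 * 2 ^ (j - 1)" "(2::real) ^ j = 2 * 2 ^ (j - 1)"
    using j by (simp_all flip: power_Suc)
  then have num: "2 ^ j / 4 * Q_sum q (2 ^ j) \<le> (\<Sum>m=1..2 ^ j. q (2 ^ j - m) * real m)"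
    using weighted_identity_lower_bound[OF q, of "2 ^ (j - 1)"] by simp
  have "Q_sum q ?n \<le> Q_sum q (2 * 2 ^ N)" using jN q0 by (intro Q_sum_mono) auto
  also have "\<dots> \<le> 2 * Q_sum q (2 ^ N)" by (rule Q_sum_double[OF q(1)])
  finally have den: "Q_sum q ?n \<le> 2 * Q_sum q (2 ^ N)" .
  have "2 ^ j * Q_sum q (2 ^ j) / (8 * Q_sum q (2 ^ N)) = 2 ^ j / 4 * Q_sum q (2 ^ j) / (2 * Q_sum q (2 ^ N))"
    by simp
  also have "\<dots> \<le> (\<Sum>m=1..2 ^ j. q (2 ^ j - m) * real m) / Q_sum q ?n"
    by (rule frac_le) (use num den Qpos q0 in \<open>auto intro!: sum_nonneg\<close>)
  finally have "2 ^ j * Q_sum q (2 ^ j) / (8 * Q_sum q (2 ^ N)) \<le> \<bar>norlund_mean q ?n (walsh_block N) x\<bar>"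
    by (simp only: eq)
  then show ?thesis
    unfolding norlund_maximal_def by (intro SUP_upper2[of ?n] ennreal_leI) (simp_all add: Suc_le_eq)
qed

text \<open>
  Integrating the lower bound over the shells between consecutive cells of \<open>0\<close> reproduces the sum in the
  condition, and the Hardy norm of the block supplies the factor in front of it.
\<close>

lemma condition_if_bounded:
  assumes q: "decseq q" "\<And>k. q k > 0" and p: "0 < p" and c: "0 \<le> c"
    and bdd: "\<And>f. f \<in> Hp_space p \<Longrightarrow> Lp_norm p (norlund_maximal q f) \<le> ennreal c * Hp_norm p f"
  shows "2 powr (real N * (1 - p)) / Q_sum q (2 ^ N) powr p
      * (\<Sum>j=1..N. Q_sum q (2 ^ j) powr p * 2 powr (real j * (p - 1))) \<le> 2 * 8 powr p * c powr p"
proof -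
  have Q: "Q_sum q (2 ^ n) > 0" for n using Q_sum_pos[of q "2 ^ n"] q by auto
  define v where "v j = 2 ^ j * Q_sum q (2 ^ j) / (8 * Q_sum q (2 ^ N))" for j
  have v: "0 \<le> v j" for j using Q[of j] Q[of N] by (simp add: v_def)
  \<comment> \<open>The shells are disjoint, so at each point at most one of the lower bounds \<open>v j\<close> is used.\<close>
  define D where "D j = cell j 0 - cell (Suc j) 0" for j
  have D_sets [measurable]: "D j \<in> sets unit_leb" for j
    unfolding D_def by (intro sets.Diff sets_cell) auto
  have "emeasure unit_leb (D j) = ennreal (1 / 2 ^ Suc j)" for j
  proof -
    have "cell (Suc j) 0 \<subseteq> cell j 0" unfolding cell_def using agree_mono[of "Suc j" _ _ j] by auto
    then have "emeasure unit_leb (D j) = ennreal (1 / 2 ^ j) - ennreal (1 / 2 ^ Suc j)"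
      unfolding D_def by (subst emeasure_Diff) (auto simp: emeasure_cell sets_cell)
    then show ?thesis by (simp add: ennreal_minus)
  qed note D_measure = this
  have le: "(\<Sum>j=1..N. ennreal (v j powr p) * indicator (D j) x)
      \<le> ennreal_powr (norlund_maximal q (walsh_block N) x) p" for x
  proof (cases "\<exists>j\<in>{1..N}. x \<in> D j")
    case True
    then obtain j where j: "j \<in> {1..N}" "x \<in> D j" by blast
    have other: "x \<notin> D i" if "i \<noteq> j" for i
    proof (cases "i < j")
      case True
      then have "agree (Suc i) 0 x" using j by (auto simp: D_def cell_def intro: agree_mono)
      then show ?thesis by (auto simp: D_def cell_def)
    next
      case False
      with that have "j < i" by simp
      then show ?thesis using j agree_mono[of i 0 x "Suc j"] by (auto simp: D_def cell_def)
    qed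
    have "(\<Sum>j=1..N. ennreal (v j powr p) * indicator (D j) x)
        = (\<Sum>i\<in>{j}. ennreal (v i powr p) * indicator (D i) x)"
      using j other by (intro sum.mono_neutral_right) auto
    also have "\<dots> = ennreal_powr (ennreal (v j)) p" using j v by (simp add: ennreal_powr_ennreal)
    also have "\<dots> \<le> ennreal_powr (norlund_maximal q (walsh_block N) x) p"
      using j p unfolding v_def
      by (intro ennreal_powr_mono norlund_maximal_walsh_block_ge q) (auto simp: D_def cell_def)
    finally show ?thesis .
  qed simp
  have "ennreal (\<Sum>j=1..N. v j powr p / 2 ^ Suc j)
      = (\<integral>\<^sup>+x. (\<Sum>j=1..N. ennreal (v j powr p) * indicator (D j) x) \<partial>unit_leb)"
    by (subst nn_integral_sum) (auto simp: nn_integral_cmult_indicator D_measure simp flip: ennreal_mult simp del: power_Suc)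
  also have "\<dots> \<le> (\<integral>\<^sup>+x. ennreal_powr (norlund_maximal q (walsh_block N) x) p \<partial>unit_leb)"
    by (intro nn_integral_mono le)
  also have "\<dots> \<le> ennreal (c powr p) * (\<integral>\<^sup>+x. ennreal_powr (dyadic_maximal (walsh_block N) x) p \<partial>unit_leb)"
    using bdd[OF walsh_block_in_Hp_space[OF p]] unfolding Hp_norm_def Lp_norm_le_iff[OF p c] .
  also have "\<dots> \<le> ennreal (c powr p) * ennreal (2 powr (real N * (p - 1)))"
    by (intro mult_left_mono Hp_integral_walsh_block p) simp
  also have "\<dots> = ennreal (c powr p * 2 powr (real N * (p - 1)))"
    by (simp add: ennreal_mult)
  finally have main: "(\<Sum>j=1..N. v j powr p / 2 ^ Suc j) \<le> c powr p * 2 powr (real N * (p - 1))"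
    by (subst (asm) ennreal_le_iff) auto
  have vj: "v j powr p / 2 ^ Suc j
      = Q_sum q (2 ^ j) powr p * 2 powr (real j * (p - 1)) / (2 * 8 powr p * Q_sum q (2 ^ N) powr p)" for j
  proof -
    have "2 powr (real j * (p - 1)) = (2 ^ j) powr p / 2 ^ j"
      by (simp add: right_diff_distrib powr_diff power2_powr powr_power powr_realpow mult.commute)
    then show ?thesis
      unfolding v_def using Q[of j] Q[of N] by (simp add: powr_mult powr_divide field_simps)
  qed
  have "2 powr (real N * (1 - p)) / Q_sum q (2 ^ N) powr p
      * (\<Sum>j=1..N. Q_sum q (2 ^ j) powr p * 2 powr (real j * (p - 1)))
    = 2 * 8 powr p * 2 powr (real N * (1 - p)) * (\<Sum>j=1..N. v j powr p / 2 ^ Suc j)"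
    unfolding vj sum_divide_distrib[symmetric] by simp
  also have "\<dots> \<le> 2 * 8 powr p * 2 powr (real N * (1 - p)) * (c powr p * 2 powr (real N * (p - 1)))"
    by (intro mult_left_mono main) simp
  also have "\<dots> = 2 * 8 powr p * c powr p * 2 powr (real N * (1 - p) + real N * (p - 1))"
    unfolding powr_add by simp
  also have "\<dots> = 2 * 8 powr p * c powr p" by (simp add: algebra_simps)
  finally show ?thesis .
qed

section \<open>Atomic decomposition\<close>

lemma walsh_coeff_add:
  assumes "integrable unit_leb f" "integrable unit_leb g"
  shows "walsh_coeff (\<lambda>x. f x + g x) i = walsh_coeff f i + walsh_coeff g i"
  unfolding walsh_coeff_def distrib_right
  using assms by (intro Bochner_Integration.integral_add integrable_mult_walsh)

lemma norlund_mean_add: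
  assumes "integrable unit_leb f" "integrable unit_leb g"
  shows "norlund_mean q n (\<lambda>x. f x + g x) x = norlund_mean q n f x + norlund_mean q n g x"
  unfolding norlund_mean_def walsh_partial_sum_def walsh_coeff_add[OF assms]
  by (simp add: distrib_left distrib_right sum.distrib add_divide_distrib)

lemma norlund_mean_const:
  assumes "n \<ge> 1" "Q_sum q n > 0"
  shows "norlund_mean q n (\<lambda>_. c) x = c"
proof -
  have coeff: "walsh_coeff (\<lambda>_. c) i = (if i = 0 then c else 0)" for i
    using walsh_coeff_polynomial[of "{0}" "\<lambda>_. c" i] by simp
  have "walsh_partial_sum k (\<lambda>_. c) x = c" if "k \<ge> 1" for k
  proof -
    have "walsh_partial_sum k (\<lambda>_. c) x = (\<Sum>i<k. if i = 0 then c else 0)"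
      unfolding walsh_partial_sum_def coeff by (intro sum.cong) auto
    then show ?thesis using that by simp
  qed
  then have "(\<Sum>k=1..n. q (n - k) * walsh_partial_sum k (\<lambda>_. c) x) = (\<Sum>k=1..n. q (n - k)) * c"
    by (simp add: sum_distrib_right)
  then show ?thesis using assms(2) by (simp add: norlund_mean_def Q_sum_rev[unfolded One_nat_def])
qed

lemma walsh_partial_sum_1: "walsh_partial_sum (Suc 0) f x = walsh_coeff f 0"
  by (simp add: walsh_partial_sum_def)

lemma walsh_coeff_partial_sum: "i < k \<Longrightarrow> walsh_coeff (walsh_partial_sum k f) i = walsh_coeff f i"
  using walsh_coeff_polynomial[of "{..<k}" "walsh_coeff f" i]
  by (simp add: walsh_partial_sum_def[abs_def])

lemma integrable_partial_sum: "integrable unit_leb (walsh_partial_sum k f)"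
  unfolding walsh_partial_sum_def[abs_def]
  by (intro Bochner_Integration.integrable_sum integrable_mult_right integrable_walsh)

text \<open>
  The increments of the martingale of partial sums of order \<open>2 ^ n\<close>.
\<close>

definition dyadic_diff :: "(real \<Rightarrow> real) \<Rightarrow> nat \<Rightarrow> real \<Rightarrow> real" where
  "dyadic_diff f n x = walsh_partial_sum (2 ^ Suc n) f x - walsh_partial_sum (2 ^ n) f x"

lemma dyadic_diff_eq:
  "dyadic_diff f n x = (-1) ^ dyadic_digit x n * (\<Sum>m<2 ^ n. walsh_coeff f (2 ^ n + m) * walsh m x)"
proof -
  have "(2::nat) ^ Suc n = 2 ^ n + 2 ^ n" by simp
  then have "dyadic_diff f n x = (\<Sum>m<2 ^ n. walsh_coeff f (2 ^ n + m) * walsh (2 ^ n + m) x)"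
    by (simp only: dyadic_diff_def walsh_partial_sum_def sum_lessThan_add add_diff_cancel_left')
  then show ?thesis by (simp add: sum_distrib_left walsh_power_add mult.left_commute)
qed

text \<open>
  The increment takes opposite values on the two halves of a cell of level \<open>n\<close>. Its absolute value is
  therefore known one level earlier than the increment itself.
\<close>

lemma dyadic_step_abs_diff: "dyadic_step n (\<lambda>x. \<bar>dyadic_diff f n x\<bar>)"
proof -
  have "\<bar>dyadic_diff f n x\<bar> = \<bar>\<Sum>m<2 ^ n. walsh_coeff f (2 ^ n + m) * walsh m x\<bar>" for x
    by (simp add: dyadic_diff_eq abs_mult power_abs)
  moreover have "(\<Sum>m<2 ^ n. walsh_coeff f (2 ^ n + m) * walsh m x)
      = (\<Sum>m<2 ^ n. walsh_coeff f (2 ^ n + m) * walsh m y)" if "agree n x y" for x y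
    using that by (intro sum.cong) (auto simp: walsh_agree)
  ultimately show ?thesis by (simp add: dyadic_step_def)
qed

lemma dyadic_step_diff: "dyadic_step (Suc n) (dyadic_diff f n)"
  using dyadic_step_partial_sum[of "2 ^ Suc n" "Suc n" f] dyadic_step_partial_sum[of "2 ^ n" "Suc n" f]
  by (auto simp: dyadic_step_def dyadic_diff_def)

lemma dyadic_diff_flip:
  assumes "dyadic_digit x n = 0"
  shows "dyadic_diff f n (x + 1 / 2 ^ Suc n) = - dyadic_diff f n x"
proof -
  have "(\<Sum>m<2 ^ n. walsh_coeff f (2 ^ n + m) * walsh m (x + 1 / 2 ^ Suc n))
      = (\<Sum>m<2 ^ n. walsh_coeff f (2 ^ n + m) * walsh m x)"
    by (intro sum.cong refl arg_cong2[where f = "(*)"] walsh_agree[OF _ agree_flip[OF assms]]) auto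
  then show ?thesis using assms by (simp add: dyadic_diff_eq dyadic_digit_flip del: power_Suc)
qed

text \<open>
  A predictable majorant of the martingale: it already controls the partial sum of order \<open>2 ^ Suc n\<close>,
  yet it is constant on cells of level \<open>n\<close>.
\<close>

definition dyadic_majorant :: "(real \<Rightarrow> real) \<Rightarrow> nat \<Rightarrow> real \<Rightarrow> real" where
  "dyadic_majorant f n x
    = Max ((\<lambda>j. \<bar>walsh_partial_sum (2 ^ j) f x\<bar> + \<bar>dyadic_diff f j x\<bar>) ` {..n})"

lemma dyadic_step_majorant: "dyadic_step n (dyadic_majorant f n)"
proof -
  have "\<bar>walsh_partial_sum (2 ^ j) f x\<bar> + \<bar>dyadic_diff f j x\<bar>
      = \<bar>walsh_partial_sum (2 ^ j) f y\<bar> + \<bar>dyadic_diff f j y\<bar>" if "agree n x y" "j \<le> n" for x y j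
    using dyadic_stepD[OF dyadic_step_partial_sum[OF order_refl] agree_mono[OF that]]
      dyadic_stepD[OF dyadic_step_abs_diff agree_mono[OF that]] by metis
  then show ?thesis
    unfolding dyadic_step_def dyadic_majorant_def
    by (intro allI impI arg_cong[where f = Max] image_cong) auto
qed

lemma majorant_ge:
  "j \<le> n \<Longrightarrow> \<bar>walsh_partial_sum (2 ^ j) f x\<bar> + \<bar>dyadic_diff f j x\<bar> \<le> dyadic_majorant f n x"
  unfolding dyadic_majorant_def by (intro Max_ge) auto

lemma majorant_mono: "m \<le> n \<Longrightarrow> dyadic_majorant f m x \<le> dyadic_majorant f n x"
  unfolding dyadic_majorant_def by (intro Max_mono) auto

lemma majorant_ge_partial_sums:
  "\<bar>walsh_partial_sum (2 ^ n) f x\<bar> \<le> dyadic_majorant f n x"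
  "\<bar>walsh_partial_sum (2 ^ Suc n) f x\<bar> \<le> dyadic_majorant f n x"
  using majorant_ge[of n n f x] unfolding dyadic_diff_def by linarith+

text \<open>
  The majorant is read off at the point \<open>x\<close> itself, so it is bounded pointwise by
  three values of the partial sums there.
\<close>

lemma majorant_le_maximal: "ennreal (dyadic_majorant f n x) \<le> ennreal 3 * dyadic_maximal f x"
proof -
  have S: "ennreal \<bar>walsh_partial_sum (2 ^ j) f x\<bar> \<le> dyadic_maximal f x" for j
    unfolding dyadic_maximal_def by (rule SUP_upper) simp
  have "dyadic_majorant f n x \<in> (\<lambda>j. \<bar>walsh_partial_sum (2 ^ j) f x\<bar> + \<bar>dyadic_diff f j x\<bar>) ` {..n}"
    unfolding dyadic_majorant_def by (rule Max_in) auto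
  then obtain j where "dyadic_majorant f n x = \<bar>walsh_partial_sum (2 ^ j) f x\<bar> + \<bar>dyadic_diff f j x\<bar>"
    by blast
  also have "\<dots> \<le> \<bar>walsh_partial_sum (2 ^ j) f x\<bar> + (\<bar>walsh_partial_sum (2 ^ Suc j) f x\<bar> + \<bar>walsh_partial_sum (2 ^ j) f x\<bar>)"
    unfolding dyadic_diff_def by linarith
  finally have "ennreal (dyadic_majorant f n x) \<le> ennreal \<bar>walsh_partial_sum (2 ^ j) f x\<bar>
      + (ennreal \<bar>walsh_partial_sum (2 ^ Suc j) f x\<bar> + ennreal \<bar>walsh_partial_sum (2 ^ j) f x\<bar>)"
    by (simp add: ennreal_leI flip: ennreal_plus)
  also have "\<dots> \<le> dyadic_maximal f x + (dyadic_maximal f x + dyadic_maximal f x)"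
    by (intro add_mono S)
  also have "\<dots> = ennreal 3 * dyadic_maximal f x"
  proof -
    have "ennreal 3 = 1 + (1 + 1)" by simp
    then show ?thesis by (simp only: distrib_right mult_1)
  qed
  finally show ?thesis .
qed

definition dyadic_scale :: "(real \<Rightarrow> real) \<Rightarrow> nat \<Rightarrow> real \<Rightarrow> int" where
  "dyadic_scale f n x = \<lceil>log 2 (dyadic_majorant f n x)\<rceil>"

lemma dyadic_scale_bounds:
  assumes "dyadic_majorant f n x > 0"
  shows "dyadic_majorant f n x \<le> 2 powr dyadic_scale f n x"
    and "2 powr dyadic_scale f n x \<le> 2 * dyadic_majorant f n x"
proof -
  show "dyadic_majorant f n x \<le> 2 powr dyadic_scale f n x"
    using assms by (simp add: dyadic_scale_def flip: log_le_iff)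
  have "of_int (dyadic_scale f n x) \<le> log 2 (dyadic_majorant f n x) + 1"
    unfolding dyadic_scale_def by linarith
  then have "2 powr dyadic_scale f n x \<le> 2 powr (log 2 (dyadic_majorant f n x) + 1)" by simp
  then show "2 powr dyadic_scale f n x \<le> 2 * dyadic_majorant f n x"
    using assms by (simp add: powr_add mult.commute)
qed

lemma dyadic_scale_mono:
  assumes "dyadic_majorant f m x > 0" "m \<le> n" shows "dyadic_scale f m x \<le> dyadic_scale f n x"
  unfolding dyadic_scale_def using assms majorant_mono[OF assms(2), of f x] by (intro ceiling_mono) simp

text \<open>
  From the first level with a positive majorant on, the scale at \<open>x\<close> is non-decreasing in the level. Levels with the same scale form a run,
  and a run starts at its first level.
\<close>

definition run_starts :: "(real \<Rightarrow> real) \<Rightarrow> nat \<Rightarrow> real \<Rightarrow> bool" where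
  "run_starts f n x \<longleftrightarrow> dyadic_majorant f n x > 0 \<and>
    (\<forall>m<n. dyadic_majorant f m x > 0 \<longrightarrow> dyadic_scale f m x \<noteq> dyadic_scale f n x)"

lemma dyadic_step_scale: "dyadic_step n (dyadic_scale f n)"
  using dyadic_step_majorant[of n f] by (auto simp: dyadic_step_def dyadic_scale_def)

lemma dyadic_step_run_starts: "dyadic_step n (run_starts f n)"
proof -
  have "run_starts f n x = run_starts f n y" if "agree n x y" for x y
  proof -
    have "dyadic_majorant f m x = dyadic_majorant f m y" "dyadic_scale f m x = dyadic_scale f m y" if "m \<le> n" for m
      by (rule dyadic_stepD[OF dyadic_step_majorant agree_mono[OF \<open>agree n x y\<close> that]]
        dyadic_stepD[OF dyadic_step_scale agree_mono[OF \<open>agree n x y\<close> that]])+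
    then show ?thesis by (simp add: run_starts_def)
  qed
  then show ?thesis by (simp add: dyadic_step_def)
qed

text \<open>
  The increments of a run add up to the difference of two partial sums, each bounded by
  \<open>2 powr dyadic_scale f n x\<close>.
\<close>

definition run_bound :: "(real \<Rightarrow> real) \<Rightarrow> nat \<Rightarrow> real \<Rightarrow> real" where
  "run_bound f n x = (if run_starts f n x then 2 * 2 powr dyadic_scale f n x else 0)"

text \<open>
  The part of \<open>f\<close> carried by the run that starts at level \<open>n\<close>, cut off at level \<open>M\<close>.
\<close>

definition run :: "(real \<Rightarrow> real) \<Rightarrow> nat \<Rightarrow> nat \<Rightarrow> real \<Rightarrow> real" where
  "run f M n x = (\<Sum>j\<in>{n..<M}. if run_starts f n x \<and> dyadic_scale f j x = dyadic_scale f n x then dyadic_diff f j x else 0)"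

lemma run_bound_nonneg: "0 \<le> run_bound f n x"
  by (simp add: run_bound_def)

lemma dyadic_step_run_bound: "dyadic_step n (run_bound f n)"
proof -
  have "run_bound f n x = run_bound f n y" if "agree n x y" for x y
    unfolding run_bound_def dyadic_stepD[OF dyadic_step_run_starts that]
      dyadic_stepD[OF dyadic_step_scale that] ..
  then show ?thesis by (simp add: dyadic_step_def)
qed

lemma dyadic_step_run: "dyadic_step M (run f M n)"
proof -
  have "(if run_starts f n x \<and> dyadic_scale f j x = dyadic_scale f n x then dyadic_diff f j x else 0)
     = (if run_starts f n y \<and> dyadic_scale f j y = dyadic_scale f n y then dyadic_diff f j y else 0)"
    if "agree M x y" "n \<le> j" "j < M" for x y j
  proof -
    have "run_starts f n x = run_starts f n y" "dyadic_scale f n x = dyadic_scale f n y" "dyadic_scale f j x = dyadic_scale f j y"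
      "dyadic_diff f j x = dyadic_diff f j y"
      using dyadic_stepD[OF dyadic_step_run_starts agree_mono[OF that(1), of n]]
        dyadic_stepD[OF dyadic_step_scale agree_mono[OF that(1), of n]]
        dyadic_stepD[OF dyadic_step_scale agree_mono[OF that(1), of j]]
        dyadic_stepD[OF dyadic_step_diff agree_mono[OF that(1), of "Suc j"]] that(2,3) by simp_all
    then show ?thesis by simp
  qed
  then show ?thesis unfolding dyadic_step_def run_def by (intro allI impI sum.cong) auto
qed

lemma sum_dyadic_diff:
  "n \<le> m \<Longrightarrow> (\<Sum>j\<in>{n..<m}. dyadic_diff f j x) = walsh_partial_sum (2 ^ m) f x - walsh_partial_sum (2 ^ n) f x"
  unfolding dyadic_diff_def by (rule sum_Suc_diff')

text \<open>
  Monotonicity of the scale makes the levels of a run an interval, so the sum of its increments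
  telescopes.
\<close>

lemma abs_run_le: "\<bar>run f M n x\<bar> \<le> run_bound f n x"
proof (cases "run_starts f n x \<and> n < M")
  case True
  then have pos: "dyadic_majorant f n x > 0" by (simp add: run_starts_def)
  define S where "S = {j \<in> {n..<M}. dyadic_scale f j x = dyadic_scale f n x}"
  have S: "finite S" "n \<in> S" using True by (auto simp: S_def)
  define m where "m = Max S"
  have m: "m \<in> S" unfolding m_def using S by (intro Max_in) auto
  have m_max: "j \<le> m" if "j \<in> S" for j unfolding m_def using S that by (intro Max_ge)
  have "S = {n..<Suc m}"
  proof
    show "S \<subseteq> {n..<Suc m}" using m_max by (auto simp: S_def less_Suc_eq_le)
    show "{n..<Suc m} \<subseteq> S"
    proof
      fix j assume j: "j \<in> {n..<Suc m}"
      have "dyadic_scale f n x \<le> dyadic_scale f j x" using pos j by (intro dyadic_scale_mono) auto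
      moreover have "dyadic_scale f j x \<le> dyadic_scale f m x"
        using pos j majorant_mono[of n j f x] by (intro dyadic_scale_mono) auto
      ultimately show "j \<in> S" using j m by (auto simp: S_def)
    qed
  qed
  have "run f M n x = (\<Sum>j\<in>S. dyadic_diff f j x)"
    using True unfolding S_def run_def by (subst sum.inter_filter) auto
  also have "\<dots> = walsh_partial_sum (2 ^ Suc m) f x - walsh_partial_sum (2 ^ n) f x"
    unfolding \<open>S = {n..<Suc m}\<close> using m by (intro sum_dyadic_diff) (auto simp: S_def)
  also have "\<bar>\<dots>\<bar> \<le> dyadic_majorant f m x + dyadic_majorant f n x"
    using majorant_ge_partial_sums(2)[of m f x] majorant_ge_partial_sums(1)[of n f x] by linarith
  also have "\<dots> \<le> 2 powr dyadic_scale f m x + 2 powr dyadic_scale f n x"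
    using pos majorant_mono[of n m f x] m by (intro add_mono dyadic_scale_bounds(1)) (auto simp: S_def)
  also have "\<dots> = run_bound f n x" using True m by (simp add: run_bound_def S_def)
  finally show ?thesis .
qed (auto simp: run_def run_bound_def)

text \<open>
  Every level at which the majorant is positive belongs to exactly one run. At the other levels the
  increment is zero.
\<close>

lemma sum_runs: "(\<Sum>n<M. run f M n x) = walsh_partial_sum (2 ^ M) f x - walsh_coeff f 0"
proof -
  have *: "(\<Sum>n<M. if run_starts f n x \<and> dyadic_scale f j x = dyadic_scale f n x \<and> n \<le> j then dyadic_diff f j x else 0)
      = dyadic_diff f j x" if "j < M" for j
  proof (cases "dyadic_majorant f j x > 0")
    case True
    \<comment> \<open>\<open>n\<close> is the first level of the run to which level \<open>j\<close> belongs.\<close>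
    define n where "n = (LEAST n. dyadic_majorant f n x > 0 \<and> dyadic_scale f n x = dyadic_scale f j x)"
    have n: "dyadic_majorant f n x > 0" "dyadic_scale f n x = dyadic_scale f j x"
      using LeastI[of "\<lambda>n. dyadic_majorant f n x > 0 \<and> dyadic_scale f n x = dyadic_scale f j x" j] True
      unfolding n_def by auto
    have least: "n \<le> i" if "dyadic_majorant f i x > 0" "dyadic_scale f i x = dyadic_scale f j x" for i
      unfolding n_def using that by (intro Least_le) simp
    have "run_starts f i x \<and> dyadic_scale f j x = dyadic_scale f i x \<and> i \<le> j \<longleftrightarrow> i = n" for i
    proof
      assume i: "run_starts f i x \<and> dyadic_scale f j x = dyadic_scale f i x \<and> i \<le> j"
      then have "n \<le> i" by (intro least) (auto simp: run_starts_def)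
      moreover have "\<not> n < i" using i n by (auto simp: run_starts_def)
      ultimately show "i = n" by simp
    next
      assume "i = n"
      moreover have "n \<le> j" using least[of j] True by simp
      moreover have "run_starts f n x"
        unfolding run_starts_def using n least by (metis not_le)
      ultimately show "run_starts f i x \<and> dyadic_scale f j x = dyadic_scale f i x \<and> i \<le> j" using n by simp
    qed
    moreover have "n < M" using least[of j] True that by simp
    ultimately show ?thesis by simp
  next
    case False
    then have "dyadic_diff f j x = 0" using majorant_ge[of j j f x] by auto
    then show ?thesis by (simp only: if_cancel sum.neutral_const)
  qed
  have "(\<Sum>n<M. run f M n x)
      = (\<Sum>n<M. \<Sum>j<M. if run_starts f n x \<and> dyadic_scale f j x = dyadic_scale f n x \<and> n \<le> j then dyadic_diff f j x else 0)"
    unfolding run_def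
    by (intro sum.cong sum.mono_neutral_cong_left refl) auto
  also have "\<dots> = (\<Sum>j<M. \<Sum>n<M. if run_starts f n x \<and> dyadic_scale f j x = dyadic_scale f n x \<and> n \<le> j then dyadic_diff f j x else 0)"
    by (rule sum.swap)
  also have "\<dots> = (\<Sum>j\<in>{0..<M}. dyadic_diff f j x)"
    by (intro sum.cong *) auto
  also have "\<dots> = walsh_partial_sum (2 ^ M) f x - walsh_coeff f 0"
    by (subst sum_dyadic_diff) (auto simp: walsh_partial_sum_1)
  finally show ?thesis .
qed

text \<open>
  Different runs through \<open>x\<close> have different integer scales, all at most that of level \<open>M\<close>, so the sum
  is dominated by a geometric series with ratio \<open>2 powr (- p)\<close> and its largest term.
\<close>

lemma sum_run_bounds:
  assumes "0 < p"
  shows "(\<Sum>n<M. run_bound f n x powr p)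
    \<le> 4 powr p * (2 powr p / (2 powr p - 1)) * dyadic_majorant f M x powr p"
proof (cases "dyadic_majorant f M x > 0")
  case False
  then have "\<not> run_starts f n x" if "n < M" for n
    using that majorant_mono[of n M f x] by (auto simp: run_starts_def)
  then have "run_bound f n x = 0" if "n < M" for n using that by (simp add: run_bound_def)
  moreover have "2 powr p > (1::real)" using assms by simp
  ultimately show ?thesis by (simp del: times_divide_eq_right)
next
  case pos: True
  define r where "r = 2 powr p"
  have r: "r > 1" using assms by (simp add: r_def)
  define K where "K = dyadic_scale f M x"
  define S where "S = {n \<in> {..<M}. run_starts f n x}"
  \<comment> \<open>\<open>e\<close> counts how far the scale of a run lies below the top scale and turns the sum into a geometric one.\<close>
  define e where "e n = nat (K - dyadic_scale f n x)" for n
  have e: "real (e n) = K - dyadic_scale f n x" if "n \<in> S" for n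
    using that dyadic_scale_mono[of f n x M] by (auto simp: e_def S_def K_def run_starts_def)
  have inj: "inj_on e S"
  proof (rule inj_onI)
    fix a b assume ab: "a \<in> S" "b \<in> S" "e a = e b"
    then have "dyadic_scale f a x = dyadic_scale f b x" using e[of a] e[of b] by simp
    then show "a = b" using ab by (auto simp: S_def run_starts_def) (metis linorder_neqE_nat)
  qed
  have summand: "run_bound f n x powr p = 2 powr p * (2 powr K) powr p * (1 / r) ^ e n" if "n \<in> S" for n
  proof -
    have "2 powr dyadic_scale f n x = 2 powr K / 2 powr e n"
      using e[OF that] by (simp flip: powr_diff)
    moreover have "(2 powr e n) powr p = r ^ e n"
      by (simp add: r_def powr_powr powr_power mult.commute)
    ultimately show ?thesis
      using that by (simp add: run_bound_def S_def powr_mult powr_divide power_one_over)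
  qed
  have "(\<Sum>n<M. run_bound f n x powr p) = (\<Sum>n\<in>S. run_bound f n x powr p)"
    unfolding S_def by (rule sum.mono_neutral_right) (auto simp: run_bound_def)
  also have "\<dots> = 2 powr p * (2 powr K) powr p * (\<Sum>n\<in>S. (1 / r) ^ e n)"
    by (simp add: summand sum_distrib_left)
  also have "(\<Sum>n\<in>S. (1 / r) ^ e n) = (\<Sum>m\<in>e ` S. (1 / r) ^ m)"
    by (simp add: sum.reindex[OF inj])
  also have "2 powr p * (2 powr K) powr p * \<dots> \<le> 2 powr p * (2 * dyadic_majorant f M x) powr p * (r / (r - 1))"
  proof (intro mult_mono mult_left_mono powr_mono2)
    show "2 powr K \<le> 2 * dyadic_majorant f M x" unfolding K_def by (rule dyadic_scale_bounds(2)[OF pos])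
    have "(\<Sum>m\<in>e ` S. (1 / r) ^ m) \<le> (\<Sum>m. (1 / r) ^ m)"
      using r by (intro sum_le_suminf summable_geometric) (auto simp: S_def)
    also have "\<dots> = r / (r - 1)"
      using r by (subst suminf_geometric) (auto simp: field_simps)
    finally show "(\<Sum>m\<in>e ` S. (1 / r) ^ m) \<le> r / (r - 1)" .
  qed (use assms r pos in \<open>auto intro!: sum_nonneg\<close>)
  also have "\<dots> = 4 powr p * (r / (r - 1)) * dyadic_majorant f M x powr p"
    using pos by (simp add: powr_mult flip: powr_mult[of 2 2 p, simplified])
  finally show ?thesis by (simp only: r_def)
qed

text \<open>
  The atoms: the part of a run that lies above the \<open>k\<close>-th cell of level \<open>n\<close>. The cell is named by its left
  end point.
\<close>

definition cell_atom :: "(real \<Rightarrow> real) \<Rightarrow> nat \<Rightarrow> nat \<Rightarrow> nat \<Rightarrow> real \<Rightarrow> real" where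
  "cell_atom f M n k x = (if x \<in> cell n (real k / 2 ^ n) then run f M n x else 0)"

lemma grid_point: "k < 2 ^ n \<Longrightarrow> 0 \<le> real k / 2 ^ n \<and> real k / 2 ^ n < 1"
  by (simp add: divide_less_eq)

lemma in_grid_cell_iff:
  assumes "0 \<le> x" "x < 1" "k < 2 ^ n"
  shows "x \<in> cell n (real k / 2 ^ n) \<longleftrightarrow> k = nat \<lfloor>2 ^ n * x\<rfloor>"
proof -
  have "\<lfloor>2 ^ n * (real k / 2 ^ n)\<rfloor> = int k" by simp
  then have "x \<in> cell n (real k / 2 ^ n) \<longleftrightarrow> int k = \<lfloor>2 ^ n * x\<rfloor>"
    using assms grid_point[OF assms(3)] agree_iff_floor_eq[of "real k / 2 ^ n" x n] by (simp add: cell_def)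
  also have "\<dots> \<longleftrightarrow> k = nat \<lfloor>2 ^ n * x\<rfloor>" using assms by (auto simp: nat_eq_iff)
  finally show ?thesis .
qed

lemma sum_over_grid:
  assumes "0 \<le> x" "x < 1"
  shows "(\<Sum>k<2 ^ n. if x \<in> cell n (real k / 2 ^ n) then F else 0) = F"
proof -
  have "\<lfloor>2 ^ n * x\<rfloor> < 2 ^ n" "0 \<le> \<lfloor>2 ^ n * x\<rfloor>" using assms by (simp_all add: floor_less_iff)
  then have lt: "nat \<lfloor>2 ^ n * x\<rfloor> < 2 ^ n" by (simp add: nat_less_iff)
  have "(\<Sum>k<2 ^ n. if x \<in> cell n (real k / 2 ^ n) then F else 0)
      = (\<Sum>k<2 ^ n. if k = nat \<lfloor>2 ^ n * x\<rfloor> then F else 0)"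
    by (intro sum.cong refl) (simp add: in_grid_cell_iff[OF assms])
  also have "\<dots> = F" using lt by (simp add: sum.delta)
  finally show ?thesis .
qed

lemma measurable_cell_atom:
  assumes "k < 2 ^ n" shows "cell_atom f M n k \<in> borel_measurable unit_leb"
proof -
  have [measurable]: "cell n (real k / 2 ^ n) \<in> sets unit_leb"
    using grid_point[OF assms] by (intro sets_cell) auto
  have [measurable]: "run f M n \<in> borel_measurable unit_leb"
    by (rule measurable_dyadic_step[OF dyadic_step_run])
  have "(\<lambda>x. indicator (cell n (real k / 2 ^ n)) x * run f M n x) \<in> borel_measurable unit_leb" by measurable
  moreover have "(\<lambda>x. indicator (cell n (real k / 2 ^ n)) x * run f M n x) = cell_atom f M n k"
    by (auto simp: cell_atom_def fun_eq_iff)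
  ultimately show ?thesis by simp
qed

lemma abs_cell_atom_le: "\<bar>cell_atom f M n k x\<bar> \<le> run_bound f n (real k / 2 ^ n)"
  using abs_run_le[of f M n x] run_bound_nonneg[of f n] dyadic_stepD[OF dyadic_step_run_bound, of n "real k / 2 ^ n" x f]
  by (auto simp: cell_atom_def cell_def)

text \<open>
  On the cell, the conditions that select the increments of level \<open>j\<close> depend on the digits below \<open>j\<close> only, and
  so does \<open>walsh i\<close>. Under the shift that flips digit \<open>j\<close> each selected increment therefore changes its
  sign while everything else stays fixed.
\<close>

lemma walsh_coeff_cell_atom:
  assumes "i < 2 ^ n" "k < 2 ^ n"
  shows "walsh_coeff (cell_atom f M n k) i = 0"
proof -
  let ?J = "cell n (real k / 2 ^ n)"
  define h where "h j x = (if x \<in> ?J \<and> run_starts f n x \<and> dyadic_scale f j x = dyadic_scale f n x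
    then dyadic_diff f j x * walsh i x else 0)" for j x
  have eq: "cell_atom f M n k x * walsh i x = (\<Sum>j\<in>{n..<M}. h j x)" for x
    by (auto simp: cell_atom_def h_def run_def sum_distrib_right intro!: sum.cong)
  have int: "integrable unit_leb (h j)" if "n \<le> j" for j
  proof -
    have diff: "integrable unit_leb (dyadic_diff f j)"
      unfolding dyadic_diff_def[abs_def]
      by (intro Bochner_Integration.integrable_diff integrable_partial_sum)
    have J: "?J \<in> sets unit_leb" using grid_point[OF assms(2)] by (intro sets_cell) auto
    define g where "g x = (if run_starts f n x \<and> dyadic_scale f j x = dyadic_scale f n x then dyadic_diff f j x * walsh i x else 0)" for x
    have "dyadic_step (Suc j) g"
    proof -
      have "g x = g y" if a: "agree (Suc j) x y" for x y
      proof -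
        have an: "agree n x y" and aj: "agree j x y"
          using agree_mono[OF a] \<open>n \<le> j\<close> by auto
        show ?thesis
          unfolding g_def dyadic_stepD[OF dyadic_step_run_starts an] dyadic_stepD[OF dyadic_step_scale an]
            dyadic_stepD[OF dyadic_step_scale aj] dyadic_stepD[OF dyadic_step_diff a] walsh_agree[OF assms(1) an] ..
      qed
      then show ?thesis by (simp add: dyadic_step_def)
    qed
    then have g: "g \<in> borel_measurable unit_leb" by (rule measurable_dyadic_step)
    have "h j = (\<lambda>x. indicator ?J x * g x)" by (auto simp: h_def g_def fun_eq_iff)
    then have "h j \<in> borel_measurable unit_leb" using g J by simp
    then show ?thesis
      by (rule Bochner_Integration.integrable_bound[OF diff]) (auto simp: h_def abs_mult)
  qed
  have zero: "(LINT x|unit_leb. h j x) = 0" if "n \<le> j" for j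
  proof (rule integral_eq_0_if_flip[of j])
    fix x :: real
    assume x: "x \<in> {0..<1}" "x + 1 / 2 ^ Suc j \<in> {0..<1}" "dyadic_digit x j = 0"
    let ?y = "x + 1 / 2 ^ Suc j"
    have aj: "agree j ?y x" by (rule agree_flip[OF x(3)])
    have an: "agree n ?y x" using agree_mono[OF aj that] .
    have J: "?y \<in> ?J \<longleftrightarrow> x \<in> ?J"
      using x(1,2) agree_trans[OF _ an] agree_trans[OF _ an[unfolded agree_sym[of n ?y]]]
      unfolding cell_def by blast
    show "h j ?y = - h j x"
      unfolding h_def J dyadic_stepD[OF dyadic_step_run_starts an] dyadic_stepD[OF dyadic_step_scale an]
        dyadic_stepD[OF dyadic_step_scale aj] walsh_agree[OF assms(1) an] dyadic_diff_flip[OF x(3)]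
      by simp
  qed
  show ?thesis
    unfolding walsh_coeff_def eq using int zero by (subst Bochner_Integration.integral_sum) auto
qed

section \<open>Sufficiency: summing over the atoms\<close>

lemma partial_sum_eq_sum_atoms:
  assumes "x \<in> {0..<1}"
  shows "walsh_partial_sum (2 ^ M) f x
    = walsh_coeff f 0 + (\<Sum>(n, k)\<in>(SIGMA n:{..<M}. {..<2 ^ n}). cell_atom f M n k x)"
proof -
  have "(\<Sum>(n, k)\<in>(SIGMA n:{..<M}. {..<2 ^ n}). cell_atom f M n k x)
      = (\<Sum>n<M. \<Sum>k<2 ^ n. cell_atom f M n k x)"
    by (rule sum.Sigma[symmetric]) auto
  also have "\<dots> = (\<Sum>n<M. run f M n x)"
    unfolding cell_atom_def using assms by (intro sum.cong sum_over_grid) auto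
  finally show ?thesis by (simp add: sum_runs)
qed

lemma integrable_cell_atom:
  assumes "k < 2 ^ n" shows "integrable unit_leb (cell_atom f M n k)"
  by (rule integrable_if_bounded[OF measurable_cell_atom[OF assms] abs_cell_atom_le])

text \<open>
  Means of order at most \<open>2 ^ M\<close> see only the Walsh coefficients below \<open>2 ^ M\<close>, hence only the partial sum of order
  \<open>2 ^ M\<close>, which is a constant plus finitely many atoms.
\<close>

lemma norlund_mean_le_atoms:
  assumes q: "\<And>k. q k > 0" and f: "integrable unit_leb f" and n: "n \<in> {1..2 ^ M}"
  shows "ennreal \<bar>norlund_mean q n f x\<bar>
    \<le> dyadic_maximal f x + (\<Sum>(m, k)\<in>(SIGMA m:{..<M}. {..<2 ^ m}). norlund_maximal q (cell_atom f M m k) x)"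
proof -
  define I where "I = (SIGMA m:{..<M}. {..<2 ^ m :: nat})"
  define a where "a i = cell_atom f M (fst i) (snd i)" for i
  have int: "integrable unit_leb (a i)" if "i \<in> I" for i
    using that by (auto simp: I_def a_def intro!: integrable_cell_atom)
  have I: "finite I" by (simp add: I_def)
  have "walsh_coeff f i = walsh_coeff (\<lambda>y. walsh_coeff f 0 + (\<Sum>i\<in>I. a i y)) i" if "i < n" for i
  proof -
    have "i < 2 ^ M" using that n by simp
    then have "walsh_coeff f i = walsh_coeff (walsh_partial_sum (2 ^ M) f) i"
      by (simp add: walsh_coeff_partial_sum)
    also have "\<dots> = walsh_coeff (\<lambda>y. walsh_coeff f 0 + (\<Sum>i\<in>I. a i y)) i"
      unfolding walsh_coeff_def
      by (intro Bochner_Integration.integral_cong refl)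
        (simp add: partial_sum_eq_sum_atoms I_def a_def case_prod_unfold walsh_coeff_def)
    finally show ?thesis .
  qed
  then have "norlund_mean q n f x = norlund_mean q n (\<lambda>y. walsh_coeff f 0 + (\<Sum>i\<in>I. a i y)) x"
    by (rule norlund_mean_cong)
  also have "\<dots> = norlund_mean q n (\<lambda>_. walsh_coeff f 0) x + norlund_mean q n (\<lambda>y. \<Sum>i\<in>I. a i y) x"
    using int by (intro norlund_mean_add) auto
  also have "norlund_mean q n (\<lambda>_. walsh_coeff f 0) x = walsh_coeff f 0"
    using n Q_sum_pos[of q n] q by (intro norlund_mean_const) auto
  also have "norlund_mean q n (\<lambda>y. \<Sum>i\<in>I. a i y) x = (\<Sum>i\<in>I. norlund_mean q n (a i) x)"
    using I int by (rule norlund_mean_sum)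
  finally have "\<bar>norlund_mean q n f x\<bar> \<le> \<bar>walsh_coeff f 0\<bar> + (\<Sum>i\<in>I. \<bar>norlund_mean q n (a i) x\<bar>)"
    using abs_triangle_ineq[of "walsh_coeff f 0" "\<Sum>i\<in>I. norlund_mean q n (a i) x"]
      sum_abs[of "\<lambda>i. norlund_mean q n (a i) x" I] by linarith
  then have "ennreal \<bar>norlund_mean q n f x\<bar>
      \<le> ennreal \<bar>walsh_coeff f 0\<bar> + (\<Sum>i\<in>I. ennreal \<bar>norlund_mean q n (a i) x\<bar>)"
    by (subst sum_ennreal) (auto simp: sum_nonneg ennreal_leI simp flip: ennreal_plus)
  also have "\<dots> \<le> dyadic_maximal f x + (\<Sum>i\<in>I. norlund_maximal q (a i) x)"
  proof (intro add_mono sum_mono)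
    show "ennreal \<bar>walsh_coeff f 0\<bar> \<le> dyadic_maximal f x"
      unfolding dyadic_maximal_def by (rule SUP_upper2[of 0]) (simp_all add: walsh_partial_sum_1)
    show "ennreal \<bar>norlund_mean q n (a i) x\<bar> \<le> norlund_maximal q (a i) x" for i
      unfolding norlund_maximal_def using n by (intro SUP_upper) auto
  qed
  finally show ?thesis by (simp add: I_def a_def case_prod_unfold)
qed

text \<open>
  The bound of a run is constant on the cell where the run starts, which turns the sum over cells into an
  integral. The constant is \<open>12 = 4 * 3\<close>: the factor \<open>4\<close> comes from the geometric series over the scales,
  the factor \<open>3\<close> from the comparison of the majorant with the maximal function.
\<close>

lemma sum_run_bounds_integral:
  assumes "0 < p"
  shows "(\<Sum>(n, k)\<in>(SIGMA n:{..<M}. {..<2 ^ n}). ennreal (run_bound f n (real k / 2 ^ n) powr p / 2 ^ n))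
    \<le> ennreal (12 powr p * (2 powr p / (2 powr p - 1)))
      * (\<integral>\<^sup>+x. ennreal_powr (dyadic_maximal f x) p \<partial>unit_leb)"
proof -
  let ?C = "4 powr p * (2 powr p / (2 powr p - 1))"
  have "2 powr p > (1::real)" using assms by simp
  then have C: "0 \<le> ?C" by simp
  have [measurable]: "run_bound f n \<in> borel_measurable unit_leb" for n
    by (rule measurable_dyadic_step[OF dyadic_step_run_bound])
  have cells: "ennreal (run_bound f n (real k / 2 ^ n) powr p / 2 ^ n)
      = (\<integral>\<^sup>+x. (if x \<in> cell n (real k / 2 ^ n) then ennreal (run_bound f n x powr p) else 0) \<partial>unit_leb)"
    if "k < 2 ^ n" for n k
  proof -
    note y = grid_point[OF that]
    have "(\<integral>\<^sup>+x. (if x \<in> cell n (real k / 2 ^ n) then ennreal (run_bound f n x powr p) else 0) \<partial>unit_leb)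
        = (\<integral>\<^sup>+x. ennreal (run_bound f n (real k / 2 ^ n) powr p) * indicator (cell n (real k / 2 ^ n)) x \<partial>unit_leb)"
      using dyadic_stepD[OF dyadic_step_run_bound, of n "real k / 2 ^ n" _ f]
      by (intro nn_integral_cong) (auto simp: cell_def split: split_indicator)
    also have "\<dots> = ennreal (run_bound f n (real k / 2 ^ n) powr p) * ennreal (1 / 2 ^ n)"
      using y by (subst nn_integral_cmult_indicator) (auto simp: sets_cell emeasure_cell)
    finally show ?thesis by (simp flip: ennreal_mult)
  qed
  have [measurable]: "cell n (real k / 2 ^ n) \<in> sets unit_leb" if "k < 2 ^ n" for n k
    using grid_point[OF that] by (intro sets_cell) auto
  have meas: "(\<lambda>x. if x \<in> cell n (real k / 2 ^ n) then ennreal (run_bound f n x powr p) else 0)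
      \<in> borel_measurable unit_leb" if "k < 2 ^ n" for n k
    using that by measurable
  have "(\<Sum>(n, k)\<in>(SIGMA n:{..<M}. {..<2 ^ n}). ennreal (run_bound f n (real k / 2 ^ n) powr p / 2 ^ n))
      = (\<Sum>n<M. \<Sum>k<2 ^ n. ennreal (run_bound f n (real k / 2 ^ n) powr p / 2 ^ n))"
    by (rule sum.Sigma[symmetric]) auto
  also have "\<dots> = (\<Sum>n<M. \<integral>\<^sup>+x. (\<Sum>k<2 ^ n. if x \<in> cell n (real k / 2 ^ n)
      then ennreal (run_bound f n x powr p) else 0) \<partial>unit_leb)"
    using meas by (intro sum.cong refl) (subst nn_integral_sum, auto simp: cells)
  also have "\<dots> = (\<Sum>n<M. \<integral>\<^sup>+x. ennreal (run_bound f n x powr p) \<partial>unit_leb)"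
    by (intro sum.cong refl nn_integral_cong sum_over_grid) auto
  also have "\<dots> = (\<integral>\<^sup>+x. (\<Sum>n<M. ennreal (run_bound f n x powr p)) \<partial>unit_leb)"
    by (rule nn_integral_sum[symmetric]) measurable
  also have "\<dots> \<le> (\<integral>\<^sup>+x. ennreal (12 powr p * (2 powr p / (2 powr p - 1))) * ennreal_powr (dyadic_maximal f x) p \<partial>unit_leb)"
  proof (rule nn_integral_mono)
    fix x
    have maj: "0 \<le> dyadic_majorant f M x" using majorant_ge_partial_sums(1)[of M f x] by linarith
    have "(\<Sum>n<M. ennreal (run_bound f n x powr p)) \<le> ennreal (?C * dyadic_majorant f M x powr p)"
      by (subst sum_ennreal) (simp, intro ennreal_leI sum_run_bounds[OF assms])
    also have "\<dots> = ennreal ?C * ennreal_powr (ennreal (dyadic_majorant f M x)) p"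
      using C maj by (simp only: ennreal_powr_ennreal ennreal_mult powr_ge_zero)
    also have "\<dots> \<le> ennreal ?C * ennreal_powr (ennreal 3 * dyadic_maximal f x) p"
      using assms by (intro mult_left_mono ennreal_powr_mono majorant_le_maximal) auto
    also have "\<dots> = ennreal ?C * (ennreal (3 powr p) * ennreal_powr (dyadic_maximal f x) p)"
      by (subst ennreal_powr_mult) simp_all
    also have "\<dots> = ennreal (?C * 3 powr p) * ennreal_powr (dyadic_maximal f x) p"
      by (subst ennreal_mult[OF C]) (simp_all only: powr_ge_zero mult.assoc)
    also have "?C * 3 powr p = 12 powr p * (2 powr p / (2 powr p - 1))"
      using powr_mult[of 4 3 p] by simp
    finally show "(\<Sum>n<M. ennreal (run_bound f n x powr p))
        \<le> ennreal (12 powr p * (2 powr p / (2 powr p - 1))) * ennreal_powr (dyadic_maximal f x) p" .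
  qed
  also have "\<dots> = ennreal (12 powr p * (2 powr p / (2 powr p - 1)))
      * (\<integral>\<^sup>+x. ennreal_powr (dyadic_maximal f x) p \<partial>unit_leb)"
    by (rule nn_integral_cmult) measurable
  finally show ?thesis .
qed

text \<open>
  For each \<open>M\<close> the supremum over \<open>n \<le> 2 ^ M\<close> is estimated through the finite decomposition into atoms. The bound
  does not depend on \<open>M\<close>, so monotone convergence yields the full maximal operator.
\<close>

lemma norlund_maximal_Hp_bound:
  fixes p A c :: real
  assumes q: "decseq q" "\<And>k. q k > 0" and p: "0 < p" "p \<le> 1"
    and bdd: "\<And>f. f \<in> Linf_space \<Longrightarrow> Linf_norm (norlund_maximal q f)
      \<le> ennreal c * Linf_norm (\<lambda>x. ennreal \<bar>f x\<bar>)" and c: "0 \<le> c"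
    and A: "\<And>N. 2 powr (real N * (1 - p)) / Q_sum q (2 ^ N) powr p
            * (\<Sum>j=1..N. Q_sum q (2 ^ j) powr p * 2 powr (real j * (p - 1))) \<le> A"
    and f: "integrable unit_leb f"
  defines "C \<equiv> 2 powr p / (2 powr p - 1)"
  shows "(\<integral>\<^sup>+x. ennreal_powr (norlund_maximal q f x) p \<partial>unit_leb)
    \<le> ennreal (1 + (c powr p + C * (A + 1)) * (12 powr p * C))
      * (\<integral>\<^sup>+x. ennreal_powr (dyadic_maximal f x) p \<partial>unit_leb)"
proof -
  let ?H = "\<integral>\<^sup>+x. ennreal_powr (dyadic_maximal f x) p \<partial>unit_leb"
  let ?D = "c powr p + C * (A + 1)"
  have "0 \<le> A" using A[of 0] by simp
  have "2 powr p > (1::real)" using p by simp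
  then have C: "0 \<le> C" by (simp add: C_def)
  have D: "0 \<le> ?D" using C \<open>0 \<le> A\<close> by simp
  define g where "g M x = (SUP n\<in>{1..2 ^ M}. ennreal \<bar>norlund_mean q n f x\<bar>)" for M x
  have [measurable]: "g M \<in> borel_measurable unit_leb" for M
    unfolding g_def by measurable
  have bound: "(\<integral>\<^sup>+x. ennreal_powr (g M x) p \<partial>unit_leb) \<le> ennreal (1 + ?D * (12 powr p * C)) * ?H" for M
  proof -
    define I where "I = (SIGMA m:{..<M}. {..<2 ^ m :: nat})"
    define a where "a i = cell_atom f M (fst i) (snd i)" for i
    have I: "finite I" by (simp add: I_def)
    have atom: "(\<integral>\<^sup>+x. ennreal_powr (norlund_maximal q (a i) x) p \<partial>unit_leb)
        \<le> ennreal ?D * ennreal (run_bound f (fst i) (real (snd i) / 2 ^ fst i) powr p / 2 ^ fst i)"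
      if "i \<in> I" for i
    proof -
      have k: "snd i < 2 ^ fst i" using that by (auto simp: I_def)
      note y = grid_point[OF k]
      have "(\<integral>\<^sup>+x. ennreal_powr (norlund_maximal q (a i) x) p \<partial>unit_leb)
          \<le> ennreal (?D * run_bound f (fst i) (real (snd i) / 2 ^ fst i) powr p / 2 ^ fst i)"
        unfolding a_def C_def
      proof (rule atom_estimate)
        show "cell_atom f M (fst i) (snd i) x = 0" if "x \<notin> cell (fst i) (real (snd i) / 2 ^ fst i)" for x
          using that by (simp add: cell_atom_def)
        show "2 powr (real (fst i) * (1 - p)) / Q_sum q (2 ^ fst i) powr p
            * (\<Sum>j=1..fst i. Q_sum q (2 ^ j) powr p * 2 powr (real j * (p - 1))) \<le> A"
          by (rule A)
      qed (use y in \<open>auto intro: q p bdd c measurable_cell_atom[OF k] abs_cell_atom_le walsh_coeff_cell_atom[OF _ k]\<close>)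
      also have "\<dots> = ennreal ?D * ennreal (run_bound f (fst i) (real (snd i) / 2 ^ fst i) powr p / 2 ^ fst i)"
        by (subst ennreal_mult[OF D, symmetric]) simp_all
      finally show ?thesis .
    qed
    have "(\<integral>\<^sup>+x. ennreal_powr (g M x) p \<partial>unit_leb)
        \<le> (\<integral>\<^sup>+x. ennreal_powr (dyadic_maximal f x) p + (\<Sum>i\<in>I. ennreal_powr (norlund_maximal q (a i) x) p) \<partial>unit_leb)"
    proof (rule nn_integral_mono)
      fix x
      have "g M x \<le> dyadic_maximal f x + (\<Sum>i\<in>I. norlund_maximal q (a i) x)"
        unfolding g_def using norlund_mean_le_atoms[OF q(2) f]
        by (intro SUP_least) (simp add: I_def a_def case_prod_unfold)
      then have "ennreal_powr (g M x) p \<le> ennreal_powr (dyadic_maximal f x + (\<Sum>i\<in>I. norlund_maximal q (a i) x)) p"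
        using p by (intro ennreal_powr_mono) auto
      also have "\<dots> \<le> ennreal_powr (dyadic_maximal f x) p + ennreal_powr (\<Sum>i\<in>I. norlund_maximal q (a i) x) p"
        by (rule ennreal_powr_add_le[OF p])
      also have "\<dots> \<le> ennreal_powr (dyadic_maximal f x) p + (\<Sum>i\<in>I. ennreal_powr (norlund_maximal q (a i) x) p)"
        by (intro add_left_mono ennreal_powr_sum_le p I)
      finally show "ennreal_powr (g M x) p \<le> \<dots>" .
    qed
    also have "\<dots> = ?H + (\<Sum>i\<in>I. \<integral>\<^sup>+x. ennreal_powr (norlund_maximal q (a i) x) p \<partial>unit_leb)"
      by (simp add: nn_integral_add nn_integral_sum)
    also have "\<dots> \<le> ?H + (\<Sum>i\<in>I. ennreal ?D * ennreal (run_bound f (fst i) (real (snd i) / 2 ^ fst i) powr p / 2 ^ fst i))"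
      by (intro add_left_mono sum_mono atom)
    also have "\<dots> = ?H + ennreal ?D * (\<Sum>i\<in>I. ennreal (run_bound f (fst i) (real (snd i) / 2 ^ fst i) powr p / 2 ^ fst i))"
      by (simp only: sum_distrib_left)
    also have "\<dots> \<le> ?H + ennreal ?D * (ennreal (12 powr p * C) * ?H)"
      using sum_run_bounds_integral[OF p(1), of f M]
      by (intro add_left_mono mult_left_mono) (simp_all add: I_def case_prod_unfold C_def)
    also have "\<dots> = ennreal (1 + ?D * (12 powr p * C)) * ?H"
    proof -
      have C': "0 \<le> 12 powr p * C" using C by simp
      have "ennreal (1 + ?D * (12 powr p * C)) = 1 + ennreal ?D * ennreal (12 powr p * C)"
        unfolding ennreal_mult[OF D C', symmetric] ennreal_1[symmetric]
        by (rule ennreal_plus) (simp_all only: zero_le_one mult_nonneg_nonneg[OF D C'])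
      then show ?thesis by (simp only: distrib_right mult_1 mult.assoc)
    qed
    finally show ?thesis .
  qed
  have "(\<integral>\<^sup>+x. ennreal_powr (norlund_maximal q f x) p \<partial>unit_leb)
      \<le> (\<integral>\<^sup>+x. (SUP M. ennreal_powr (g M x) p) \<partial>unit_leb)"
  proof (rule nn_integral_mono)
    fix x
    have "norlund_maximal q f x \<le> (SUP M. g M x)"
      unfolding norlund_maximal_def
    proof (rule SUP_least)
      fix n :: nat assume "n \<in> {1..}"
      then have "n \<in> {1..2 ^ n}" by (simp add: less_imp_le)
      then have "ennreal \<bar>norlund_mean q n f x\<bar> \<le> g n x" unfolding g_def by (rule SUP_upper)
      also have "\<dots> \<le> (SUP M. g M x)" by (rule SUP_upper) simp
      finally show "ennreal \<bar>norlund_mean q n f x\<bar> \<le> (SUP M. g M x)" .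
    qed
    then have "ennreal_powr (norlund_maximal q f x) p \<le> ennreal_powr (SUP M. g M x) p"
      using p by (intro ennreal_powr_mono) auto
    also have "\<dots> \<le> (SUP M. ennreal_powr (g M x) p)" by (rule ennreal_powr_SUP_le[OF p(1)])
    finally show "ennreal_powr (norlund_maximal q f x) p \<le> (SUP M. ennreal_powr (g M x) p)" .
  qed
  also have "\<dots> = (SUP M. \<integral>\<^sup>+x. ennreal_powr (g M x) p \<partial>unit_leb)"
  proof (rule nn_integral_monotone_convergence_SUP)
    have "g M x \<le> g M' x" if "M \<le> M'" for M M' x
    proof -
      have "(2::nat) ^ M \<le> 2 ^ M'" using that by simp
      then show ?thesis unfolding g_def by (intro SUP_subset_mono) auto
    qed
    then show "incseq (\<lambda>M x. ennreal_powr (g M x) p)"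
      using p by (auto simp: incseq_def le_fun_def intro!: ennreal_powr_mono)
  qed measurable
  also have "\<dots> \<le> ennreal (1 + ?D * (12 powr p * C)) * ?H" by (intro SUP_least bound)
  finally show ?thesis .
qed

section \<open>The characterization\<close>

theorem theorem3:
  fixes q :: "nat \<Rightarrow> real" and p :: real
  assumes "decseq q"
    and "\<And>k. q k > 0"
    and "filterlim (Q_sum q) at_top sequentially"
    and "bounded_operator (norlund_maximal q)
           Linf_space (\<lambda>f. Linf_norm (\<lambda>x. ennreal \<bar>f x\<bar>)) Linf_norm"
    and "1 / 2 < p" and "p \<le> 1"
  shows "bounded_operator (norlund_maximal q) (Hp_space p) (Hp_norm p) (Lp_norm p)
    \<longleftrightarrow> bdd_above (range (\<lambda>N::nat.
          2 powr (real N * (1 - p)) / Q_sum q (2 ^ N) powr p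
            * (\<Sum>j=1..N. Q_sum q (2 ^ j) powr p * 2 powr (real j * (p - 1)))))"
    (is "?bounded \<longleftrightarrow> bdd_above (range ?S)")
proof
  have p: "0 < p" using assms(5) by simp
  show "bdd_above (range ?S)" if bounded: ?bounded
  proof -
    obtain c where c: "0 \<le> c"
      and bdd: "\<And>f. f \<in> Hp_space p \<Longrightarrow> Lp_norm p (norlund_maximal q f) \<le> ennreal c * Hp_norm p f"
      using bounded unfolding bounded_operator_def by metis
    have "?S N \<le> 2 * 8 powr p * c powr p" for N
      using assms(1,2) p c bdd by (rule condition_if_bounded)
    then show ?thesis by (intro bdd_aboveI2)
  qed
  show ?bounded if bdd_S: "bdd_above (range ?S)"
  proof -
    obtain A where A: "?S N \<le> A" for N
      using bdd_S unfolding bdd_above_def by auto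
    obtain c where c: "0 \<le> c"
      and bdd: "\<And>f. f \<in> Linf_space \<Longrightarrow> Linf_norm (norlund_maximal q f)
        \<le> ennreal c * Linf_norm (\<lambda>x. ennreal \<bar>f x\<bar>)"
      using assms(4) unfolding bounded_operator_def by metis
    define C where "C = 2 powr p / (2 powr p - 1)"
    define K where "K = 1 + (c powr p + C * (A + 1)) * (12 powr p * C)"
    have "2 powr p > (1::real)" using p by simp
    moreover have "0 \<le> A" using A[of 0] by simp
    ultimately have K: "0 \<le> K" by (simp add: K_def C_def)
    have "Lp_norm p (norlund_maximal q f) \<le> ennreal (K powr (1 / p)) * Hp_norm p f"
      if "f \<in> Hp_space p" for f
    proof -
      have f: "integrable unit_leb f" using that by (simp add: Hp_space_def)
      have "(\<integral>\<^sup>+x. ennreal_powr (norlund_maximal q f x) p \<partial>unit_leb)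
          \<le> ennreal K * (\<integral>\<^sup>+x. ennreal_powr (dyadic_maximal f x) p \<partial>unit_leb)"
        unfolding K_def C_def
        using assms(1,2) p assms(6) bdd c A f by (rule norlund_maximal_Hp_bound)
      also have "K = (K powr (1 / p)) powr p" using K p by (simp add: powr_powr)
      finally show ?thesis
        unfolding Hp_norm_def using p by (subst Lp_norm_le_iff) auto
    qed
    then show ?thesis
      unfolding bounded_operator_def by (intro exI[of _ "K powr (1 / p)"]) simp
  qed
qed

end
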